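(* (i) For any $\beta>0$ and integer $d\ge1$ there exists a finite constant $C_1=C_1(\beta,d)$ such that $$\sqrt{\gamma(2-\gamma)}\;\mathsf{TV}(\mu,\nu)^{\frac{2\beta+d+\gamma}{2\beta}}\le C_1\,\big(\|\mu\|_{\beta,2}^2+\|\nu\|_{\beta,2}^2\big)^{\frac{d+\gamma}{4\beta}}\;\mathcal E_\gamma(\mu,\nu)$$ for all $\mu,\nu\in\mathcal P_S(\beta,d,\infty)$ and all $\gamma\in(0,2)$. (ii) For any integer $d\ge1$ there exists a finite constant $C_2=C_2(d)$ such that $$\frac{\sqrt{\gamma(2-\gamma)}\;\mathsf{TV}(\mu,\nu)}{\log\big(3+1/\mathsf{TV}(\mu,\nu)\big)^{\frac{2d+\gamma}4}}\le C_2\,\mathcal E_\gamma(\mu,\nu)$$ for all $\mu,\nu\in\mathcal P_G(d)$ and all $\gamma\in(0,2)$ (the left side is read as $0$ when $\mathsf{TV}(\mu,\nu)=0$).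
   Context: $\mathbb B(0,1)$ is the closed Euclidean unit ball of $\mathbb R^d$. Fourier transform: $\widehat f(\omega)=\int_{\mathbb R^d}e^{-i\langle x,\omega\rangle}f(x)\,dx$. For $f\in L^2(\mathbb R^d)$, $\|f\|_{\beta,2}^2=\int_{\mathbb R^d}\|\omega\|^{2\beta}|\widehat f(\omega)|^2\,d\omega$; for a distribution $\mu$ with density $p$, $\|\mu\|_{\beta,2}=\|p\|_{\beta,2}$. $\mathcal P_S(\beta,d,\infty)$ is the set of probability distributions on $\mathbb R^d$ supported in $\mathbb B(0,1)$ having a density $p\in L^2(\mathbb R^d)$ with $\|p\|_{\beta,2}<\infty$. $\mathcal P_G(d)=\{\rho*\mathcal N(0,I_d):\rho \text{ a probability distribution with }\operatorname{supp}(\rho)\subseteq\mathbb B(0,1)\}$. $\mathsf{TV}(\mu,\nu)=\sup_{A}[\mu(A)-\nu(A)]$ over measurable sets. The generalized energy distance $\mathcal E_\gamma(\mu,\nu)\ge0$ is given by $\mathcal E_\gamma^2(\mu,\nu)=\mathbb E\big[2\|X-Y\|^\gamma-\|X-X'\|^\gamma-\|Y-Y'\|^\gamma\big]$ with $(X,X',Y,Y')\sim\mu^{\otimes2}\otimes\nu^{\otimes2}$. *)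

theory Defs
  imports "HOL-Probability.Probability"
begin

definition fourier :: "(real ^ 'n \<Rightarrow> complex) \<Rightarrow> real ^ 'n \<Rightarrow> complex" where
  "fourier f \<omega> = (LINT x|lborel. exp (- \<i> * of_real (x \<bullet> \<omega>)) * f x)"

definition has_sobolev_norm :: "real \<Rightarrow> (real ^ 'n \<Rightarrow> real) \<Rightarrow> bool" where
  "has_sobolev_norm \<beta> p \<longleftrightarrow>
     integrable lborel
       (\<lambda>\<omega>. norm \<omega> powr (2 * \<beta>) * (cmod (fourier (\<lambda>x. of_real (p x)) \<omega>))\<^sup>2)"

(* The integral formula for the Fourier transform is only meaningful for integrable functions; it
   is applied below to probability densities.  The value 0 is returned when the integral diverges,
   so finiteness has to be demanded separately by has_sobolev_norm. *)
definition sobolev_norm :: "real \<Rightarrow> (real ^ 'n \<Rightarrow> real) \<Rightarrow> real" where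
  "sobolev_norm \<beta> p =
     sqrt (LINT \<omega>|lborel. norm \<omega> powr (2 * \<beta>) * (cmod (fourier (\<lambda>x. of_real (p x)) \<omega>))\<^sup>2)"

definition measure_sobolev_norm :: "real \<Rightarrow> (real ^ 'n) measure \<Rightarrow> real" where
  "measure_sobolev_norm \<beta> \<mu> = sobolev_norm \<beta> (\<lambda>x. enn2real (RN_deriv lborel \<mu> x))"

definition support :: "'a::topological_space measure \<Rightarrow> 'a set" where
  "support \<mu> = {x. \<forall>U. open U \<longrightarrow> x \<in> U \<longrightarrow> 0 < emeasure \<mu> U}"

definition ball_distributions :: "(real ^ 'n) measure set" where
  "ball_distributions = {\<mu>. prob_space \<mu> \<and> sets \<mu> = sets borel \<and> support \<mu> \<subseteq> cball 0 1}"

definition smooth_distributions :: "real \<Rightarrow> (real ^ 'n) measure set" where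
  "smooth_distributions \<beta> =
     {\<mu> \<in> ball_distributions. \<exists>p.
        p \<in> borel_measurable borel \<and> (\<forall>x. 0 \<le> p x) \<and>
        \<mu> = density lborel (\<lambda>x. ennreal (p x)) \<and>
        integrable lborel (\<lambda>x. (p x)\<^sup>2) \<and> has_sobolev_norm \<beta> p}"

definition std_gaussian :: "(real ^ 'n) measure" where
  "std_gaussian =
     density lborel
       (\<lambda>x. ennreal ((2 * pi) powr (- real CARD('n) / 2) * exp (- (norm x)\<^sup>2 / 2)))"

definition gaussian_mixtures :: "(real ^ 'n) measure set" where
  "gaussian_mixtures = {\<rho> \<star> std_gaussian | \<rho>. \<rho> \<in> ball_distributions}"

definition TV :: "'a measure \<Rightarrow> 'a measure \<Rightarrow> real" where
  "TV \<mu> \<nu> = (SUP A\<in>sets \<mu>. measure \<mu> A - measure \<nu> A)"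

(* The integral is nonnegative for 0 < \<gamma> < 2 and measures with finite \<gamma>-th moments, so that the
   square root is the one intended. *)
definition energy_distance ::
    "real \<Rightarrow> 'a::{second_countable_topology, real_normed_vector} measure \<Rightarrow> 'a measure \<Rightarrow> real" where
  "energy_distance \<gamma> \<mu> \<nu> =
     sqrt (LINT ((x, x'), (y, y'))|((\<mu> \<Otimes>\<^sub>M \<mu>) \<Otimes>\<^sub>M (\<nu> \<Otimes>\<^sub>M \<nu>)).
       2 * norm (x - y) powr \<gamma> - norm (x - x') powr \<gamma> - norm (y - y') powr \<gamma>)"

lemma measure_sobolev_norm_density:
  assumes p: "p \<in> borel_measurable borel" "\<And>x. 0 \<le> p x"
    and \<mu>: "\<mu> = density lborel (\<lambda>x. ennreal (p x))"
  shows "measure_sobolev_norm \<beta> \<mu> = sobolev_norm \<beta> p"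
proof -
  have "AE x in lborel. ennreal (p x) = RN_deriv lborel \<mu> x"
    by (rule sigma_finite_measure.RN_deriv_unique[OF lborel.sigma_finite_measure_axioms]) (use p \<mu> in auto)
  then have ae: "AE x in lborel. enn2real (RN_deriv lborel \<mu> x) = p x"
    by eventually_elim (metis enn2real_ennreal p(2))
  have [measurable]: "p \<in> borel_measurable borel" by fact
  have [measurable]: "RN_deriv lborel \<mu> \<in> borel_measurable borel"
    using borel_measurable_RN_deriv[of lborel \<mu>] by simp
  have "fourier (\<lambda>x. of_real (enn2real (RN_deriv lborel \<mu> x))) = fourier (\<lambda>x. of_real (p x))"
    unfolding fourier_def
    by (rule ext, rule integral_cong_AE) (use ae in auto)
  then show ?thesis
    by (simp add: measure_sobolev_norm_def sobolev_norm_def)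
qed

lemma std_gaussian_eq_prod:
  "(std_gaussian :: (real ^ 'n) measure) =
     density lborel (\<lambda>x. ennreal (\<Prod>i\<in>UNIV. std_normal_density (x $ i)))"
proof -
  have "(2 * pi) powr (- real CARD('n) / 2) * exp (- (norm x)\<^sup>2 / 2)
      = (\<Prod>i\<in>UNIV. std_normal_density (x $ i))" for x :: "real ^ 'n"
  proof -
    have 1: "(norm x)\<^sup>2 = (\<Sum>i\<in>UNIV. (x $ i)\<^sup>2)"
      by (simp add: norm_vec_def L2_set_def sum_nonneg)
    have 2: "(2 * pi) powr (- real CARD('n) / 2) = (1 / sqrt (2 * pi)) ^ CARD('n)"
    proof -
      have "1 / sqrt (2 * pi) = (2 * pi) powr (- 1 / 2)"
        by (simp add: powr_minus powr_half_sqrt field_simps)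
      then show ?thesis
        by (simp add: powr_powr flip: powr_realpow)
    qed
    show ?thesis
      unfolding std_normal_density_def prod.distrib 1 2
      by (simp add: exp_sum[symmetric] sum_negf sum_divide_distrib)
  qed
  then show ?thesis by (simp add: std_gaussian_def)
qed

lemma emeasure_Compl_support:
  fixes \<mu> :: "'a::second_countable_topology measure"
  assumes "sets \<mu> = sets borel"
  shows "emeasure \<mu> (- support \<mu>) = 0"
proof -
  define F where "F = {U. open U \<and> emeasure \<mu> U = 0}"
  have "\<And>S. S \<in> F \<Longrightarrow> open S" by (auto simp: F_def)
  from Lindelof[OF this] obtain F' where F': "F' \<subseteq> F" "countable F'" "\<Union> F' = \<Union> F"
    by metis
  have "- support \<mu> = \<Union> F"
    by (auto simp: support_def F_def not_gr_zero)
  moreover have "\<Union> F' \<in> null_sets \<mu>"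
  proof (rule null_sets_UN'[where N="\<lambda>x. x" and I=F', simplified])
    fix S assume "S \<in> F'"
    with F'(1) show "S \<in> null_sets \<mu>" by (auto simp: null_sets_def F_def assms)
  qed (fact F')
  ultimately show ?thesis by (simp add: F' null_sets_def)
qed

lemma support_subset_closed_iff:
  fixes \<mu> :: "'a::second_countable_topology measure"
  assumes "sets \<mu> = sets borel" "closed K"
  shows "support \<mu> \<subseteq> K \<longleftrightarrow> emeasure \<mu> (- K) = 0"
proof
  assume K: "support \<mu> \<subseteq> K"
  have "closed (support \<mu>)"
  proof -
    have "- support \<mu> = \<Union> {U. open U \<and> emeasure \<mu> U = 0}"
      by (auto simp: support_def not_gr_zero)
    then have "open (- support \<mu>)" by auto
    then show ?thesis by (simp add: closed_def)
  qed
  then have "- support \<mu> \<in> sets \<mu>" using assms by auto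
  with K have "emeasure \<mu> (- K) \<le> emeasure \<mu> (- support \<mu>)"
    by (intro emeasure_mono) auto
  with emeasure_Compl_support[OF assms(1)] show "emeasure \<mu> (- K) = 0" by simp
next
  assume "emeasure \<mu> (- K) = 0"
  with assms(2) show "support \<mu> \<subseteq> K"
    by (force simp: support_def closed_def)
qed

end

theory Submission
  imports Defs
begin

text \<open>
  Write \<open>\<phi>\<close> for the Fourier transform of a measure and \<open>D = |\<phi>\<^sub>\<mu> - \<phi>\<^sub>\<nu>|\<^sup>2\<close>.
  The power \<open>|z|\<^sup>\<gamma>\<close> is a mixture of the functions \<open>1 - exp (-t |z|\<^sup>2)\<close> with weight
  \<open>t powr (-\<gamma>/2 - 1)\<close>, normalised by a constant that is at most \<open>4 / (\<gamma> (2 - \<gamma>))\<close>.  Hence the squared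
  energy distance is a mixture of the Gaussian averages of \<open>D\<close>, and keeping only the scales
  \<open>R\<^sup>2 \<le> t \<le> 2 R\<^sup>2\<close> bounds \<open>\<gamma> (2 - \<gamma>)\<close> times the integral of \<open>D\<close> over the ball of radius \<open>R\<close>
  by a multiple of \<open>R powr (d + \<gamma>)\<close> times the squared energy distance.  In the other direction, Gaussian
  smoothing and the Parseval identity for the smoothed densities bound \<open>\<mu> A - \<nu> A\<close>, for \<open>A\<close> in a ball
  of radius \<open>r\<close>, by a multiple of \<open>r powr (d/2)\<close> times the square root of the integral of \<open>D\<close>.  The
  frequencies outside the ball of radius \<open>R\<close> are controlled by the Sobolev norm, respectively by the
  Gaussian decay of \<open>\<phi>\<close>; it remains to choose \<open>R\<close> (and \<open>r = R\<close> of order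
  \<open>sqrt (ln (3 + 1/TV))\<close> for mixtures).
\<close>

section \<open>The Gaussian density and its Fourier transform\<close>

text \<open>All constants must be uniform in \<open>\<gamma>\<close>, so the mixture constant is
  bounded explicitly: \<open>4 / (\<gamma> * (2 - \<gamma>))\<close> degenerates at both ends of the
  range, and this is the factor under the square root in the theorem. One identity serves both
  directions: the mean of \<open>exp (- t * |X - Y|^2)\<close> is a Gaussian average of the product
  of the transforms. Its coefficients give the energy distance, and it also gives L2 inner products
  of smoothed densities, since a product of two Gaussians integrates to a Gaussian in the difference
  of the centres. The resulting L2 bound does not depend on the smoothing width, so the width can
  tend to 0. An L2 bound controls sets only at the price of their volume. In the smooth case that
  volume is a constant. For mixtures it grows like \<open>r powr d\<close>, on top of the
  \<open>r powr (d + \<gamma>)\<close> paid for the frequencies; the square root of the product is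
  \<open>r powr (d + \<gamma> / 2)\<close>, and \<open>r\<close> of order \<open>sqrt L\<close>
  gives the logarithmic exponent \<open>(2 * d + \<gamma>) / 4\<close>.\<close>

lemma
  fixes f :: "'a::euclidean_space \<Rightarrow> real \<Rightarrow> 'b::{real_normed_field, banach, second_countable_topology}"
  assumes "\<And>b. b \<in> Basis \<Longrightarrow> integrable lborel (f b)"
  shows integral_lborel_prod:
      "(LINT x|lborel. (\<Prod>b\<in>Basis. f b (x \<bullet> b))) = (\<Prod>b\<in>Basis. LINT t|lborel. f b t)"
    and integrable_lborel_prod:
      "integrable lborel (\<lambda>x. \<Prod>b\<in>Basis. f b (x \<bullet> b))"
proof -
  interpret product_sigma_finite "\<lambda>_::'a. lborel :: real measure" ..
  have [measurable]: "f b \<in> borel_measurable borel" if "b \<in> Basis" for b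
    using borel_measurable_integrable[OF assms[OF that]] by simp
  have eq: "(\<Prod>b\<in>Basis. f b ((\<Sum>b'\<in>Basis. x b' *\<^sub>R b') \<bullet> b)) = (\<Prod>b\<in>Basis. f b (x b))"
    for x :: "'a \<Rightarrow> real"
    by (intro prod.cong) auto
  have m: "(\<lambda>x. \<Prod>b\<in>Basis. f b (x \<bullet> b)) \<in> borel_measurable borel"
    by measurable
  have s: "(\<lambda>x. \<Sum>b\<in>Basis. x b *\<^sub>R b) \<in> measurable (\<Pi>\<^sub>M b\<in>(Basis::'a set). lborel) borel"
    by measurable
  show "(LINT x|lborel. (\<Prod>b\<in>Basis. f b (x \<bullet> b))) = (\<Prod>b\<in>Basis. LINT t|lborel. f b t)"
    by (subst lborel_eq, subst integral_distr[OF s m])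
       (simp add: eq product_integral_prod assms)
  show "integrable lborel (\<lambda>x. \<Prod>b\<in>Basis. f b (x \<bullet> b))"
    by (subst lborel_eq, subst integrable_distr_eq[OF s m])
       (simp add: eq product_integrable_prod assms)
qed

text \<open>Rescaling by \<open>s\<close> turns the integral into the characteristic function of the
  standard normal law at \<open>s * u\<close>.\<close>

lemma integral_normal_density_cis:
  assumes "0 < s"
  shows "(LINT t|lborel. cis (u * t) * normal_density 0 s t) = exp (- (s * u)\<^sup>2 / 2)"
proof -
  have "(LINT t|lborel. cis (u * t) * normal_density 0 s t)
      = s *\<^sub>R (LINT t|lborel. cis (u * (0 + s * t)) * normal_density 0 s (0 + s * t))"
    using assms by (subst lborel_integral_real_affine[of s _ 0]) auto
  also have "\<dots> = (LINT t|lborel. s *\<^sub>R (cis (u * (0 + s * t)) * normal_density 0 s (0 + s * t)))"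
    by simp
  also have "\<dots> = (LINT t|lborel. std_normal_density t *\<^sub>R iexp ((s * u) * t))"
    using assms
    by (intro Bochner_Integration.integral_cong refl)
       (simp add: normal_density_def cis_conv_exp real_sqrt_mult scaleR_conv_of_real
         power_mult_distrib mult_ac)
  also have "\<dots> = char std_normal_distribution (s * u)"
    unfolding char_def by (subst integral_density) auto
  also have "\<dots> = exp (- (s * u)\<^sup>2 / 2)"
    by (simp add: char_std_normal_distribution)
  finally show ?thesis .
qed

lemma norm_sq_eq_sum: "(norm (x::'a::euclidean_space))\<^sup>2 = (\<Sum>b\<in>Basis. (x \<bullet> b)\<^sup>2)"
  by (subst power2_norm_eq_inner, subst euclidean_inner) (simp add: power2_eq_square)

text \<open>Density of the centred normal law with covariance \<open>s\<^sup>2\<close> times the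
  identity. It serves both as a smoothing kernel in space and as a weight on frequencies.\<close>

definition gauss :: "real \<Rightarrow> 'a::euclidean_space \<Rightarrow> real" where
  "gauss s x = (2 * pi * s\<^sup>2) powr (- real DIM('a) / 2) * exp (- (norm x)\<^sup>2 / (2 * s\<^sup>2))"

lemma gauss_nonneg [simp]: "0 \<le> gauss s x"
  by (simp add: gauss_def)

lemma gauss_measurable [measurable]: "gauss s \<in> borel_measurable borel"
  unfolding gauss_def by measurable

lemma gauss_eq_prod:
  fixes x :: "'a::euclidean_space"
  assumes "0 < s"
  shows "gauss s x = (\<Prod>b\<in>Basis. normal_density 0 s (x \<bullet> b))"
proof -
  have "(\<Prod>b\<in>(Basis::'a set). 1 / sqrt (2 * pi * s\<^sup>2)) = (2 * pi * s\<^sup>2) powr (- real DIM('a) / 2)"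
  proof -
    have c: "0 < 2 * pi * s\<^sup>2"
      using assms by simp
    define c where "c = 2 * pi * s\<^sup>2"
    have "1 / sqrt c = c powr (- 1 / 2)"
      using c unfolding c_def[symmetric] by (simp add: powr_minus powr_half_sqrt field_simps)
    then have "(\<Prod>b\<in>(Basis::'a set). 1 / sqrt c) = (c powr (- 1 / 2)) powr real DIM('a)"
      using c unfolding c_def[symmetric] by (simp add: powr_realpow)
    then show ?thesis
      unfolding c_def[symmetric] by (simp add: powr_powr)
  qed
  moreover have "(\<Prod>b\<in>(Basis::'a set). exp (- (x \<bullet> b)\<^sup>2 / (2 * s\<^sup>2))) = exp (- (norm x)\<^sup>2 / (2 * s\<^sup>2))"
  proof -
    have "- (norm x)\<^sup>2 / (2 * s\<^sup>2) = (\<Sum>b\<in>Basis. - (x \<bullet> b)\<^sup>2 / (2 * s\<^sup>2))"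
      unfolding norm_sq_eq_sum by (simp only: sum_negf[symmetric] sum_divide_distrib)
    then show ?thesis
      by (simp only: exp_sum[OF finite_Basis])
  qed
  ultimately show ?thesis
    by (simp only: gauss_def normal_density_def prod.distrib diff_0_right)
qed

text \<open>Density and character both factor over the coordinates, which reduces everything to the
  one-dimensional normal law.\<close>

lemma
  fixes z :: "'a::euclidean_space"
  assumes "0 < s"
  shows integrable_gauss: "integrable lborel (gauss s :: 'a \<Rightarrow> real)"
    and integral_gauss: "(LINT x|lborel. gauss s (x::'a)) = 1"
    and integral_gauss_cis:
      "(LINT x|lborel. cis (z \<bullet> x) * gauss s x) = exp (- s\<^sup>2 * (norm z)\<^sup>2 / 2)"
proof -
  have eq: "gauss s = (\<lambda>x::'a. \<Prod>b\<in>Basis. normal_density 0 s (x \<bullet> b))"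
    using gauss_eq_prod[OF assms] by auto
  show "integrable lborel (gauss s :: 'a \<Rightarrow> real)"
    unfolding eq using assms by (intro integrable_lborel_prod) auto
  show "(LINT x|lborel. gauss s (x::'a)) = 1"
    unfolding eq using assms by (subst integral_lborel_prod) auto
  have cis: "cis (z \<bullet> x) = (\<Prod>b\<in>Basis. cis ((z \<bullet> b) * (x \<bullet> b)))" for x
    by (simp add: euclidean_inner[of z x] cis_conv_exp exp_sum sum_distrib_left)
  have "(LINT x|lborel. cis (z \<bullet> x) * gauss s x)
      = (LINT x|lborel. (\<Prod>b\<in>Basis. cis ((z \<bullet> b) * (x \<bullet> b)) * normal_density 0 s (x \<bullet> b)))"
    by (simp add: cis eq prod.distrib)
  also have "\<dots> = (\<Prod>b\<in>Basis. LINT t|lborel. cis ((z \<bullet> b) * t) * normal_density 0 s t)"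
  proof (rule integral_lborel_prod)
    fix b :: 'a
    show "integrable lborel (\<lambda>t. cis ((z \<bullet> b) * t) * complex_of_real (normal_density 0 s t))"
      by (rule Bochner_Integration.integrable_bound[OF integrable_normal_density[OF assms, of 0]])
         (auto simp: norm_mult cis_conv_exp)
  qed
  also have "\<dots> = (\<Prod>b\<in>Basis. complex_of_real (exp (- (s * (z \<bullet> b))\<^sup>2 / 2)))"
    using assms by (simp add: integral_normal_density_cis)
  also have "\<dots> = of_real (exp (\<Sum>b\<in>Basis. - (s * (z \<bullet> b))\<^sup>2 / 2))"
    by (simp add: exp_sum)
  also have "(\<Sum>b\<in>Basis. - (s * (z \<bullet> b))\<^sup>2 / 2) = - s\<^sup>2 * (norm z)\<^sup>2 / 2"
    by (simp add: norm_sq_eq_sum power_mult_distrib sum_distrib_left sum_divide_distrib sum_negf)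
  finally show "(LINT x|lborel. cis (z \<bullet> x) * gauss s x) = exp (- s\<^sup>2 * (norm z)\<^sup>2 / 2)" .
qed

lemma nn_integral_gauss:
  "0 < s \<Longrightarrow> (\<integral>\<^sup>+x. ennreal (gauss s (x::'a::euclidean_space)) \<partial>lborel) = 1"
  by (subst nn_integral_eq_integral) (auto simp: integrable_gauss integral_gauss)

lemma prob_space_gauss:
  "0 < s \<Longrightarrow> prob_space (density lborel (\<lambda>x::'a::euclidean_space. ennreal (gauss s x)))"
  by (intro prob_spaceI) (simp add: emeasure_density nn_integral_gauss)

section \<open>Fourier transforms of probability measures\<close>

lemma integrable_bounded_prob:
  fixes f :: "'a \<Rightarrow> 'b::{banach, second_countable_topology}"
  assumes "prob_space M" "f \<in> borel_measurable M" "\<And>x. norm (f x) \<le> B"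
  shows "integrable M f"
proof -
  interpret prob_space M by fact
  show ?thesis by (rule integrable_const_bound[of _ B]) (use assms in auto)
qed

lemma Fubini_bounded_prob:
  fixes f :: "'a \<Rightarrow> 'b \<Rightarrow> 'c::{banach, second_countable_topology}"
  assumes M: "prob_space M" and N: "prob_space N"
    and f: "(\<lambda>(x, y). f x y) \<in> borel_measurable (M \<Otimes>\<^sub>M N)" and b: "\<And>x y. norm (f x y) \<le> B"
  shows "(LINT y|N. LINT x|M. f x y) = (LINT x|M. LINT y|N. f x y)"
proof -
  interpret M: prob_space M by fact
  interpret N: prob_space N by fact
  interpret pair_prob_space M N ..
  show ?thesis
    by (rule Fubini_integral, rule integrable_bounded_prob[of _ _ B])
       (use f b in \<open>auto simp: split_beta' prob_space_axioms\<close>)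
qed

text \<open>The characteristic function at \<open>- \<omega>\<close>. Defined for measures, it
  covers smooth distributions and mixtures alike; \<open>fourier_eq_ft\<close> links it to
  \<open>fourier\<close> of a density.\<close>

definition ft :: "'a::euclidean_space measure \<Rightarrow> 'a \<Rightarrow> complex" where
  "ft M \<omega> = (LINT x|M. cis (- (x \<bullet> \<omega>)))"

text \<open>The Gaussian kernel averaged over independent \<open>X\<close>, \<open>Y\<close> with
  laws \<open>P\<close>, \<open>Q\<close>. The combination \<open>PP + QQ - 2 PQ\<close> of these
  means is a squared kernel discrepancy (MMD).\<close>

definition gauss_mean :: "real \<Rightarrow> 'a::euclidean_space measure \<Rightarrow> 'a measure \<Rightarrow> real" where
  "gauss_mean t P Q = (LINT x|P. LINT y|Q. exp (- t * (norm (x - y))\<^sup>2))"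

lemma cis_inner_measurable [measurable]:
  assumes [measurable]: "f \<in> borel_measurable M" "g \<in> borel_measurable M"
  shows "(\<lambda>x. cis (f x \<bullet> (g x :: 'a::euclidean_space))) \<in> borel_measurable M"
  unfolding cis_conv_exp by measurable

lemma cis_minus_inner_measurable [measurable]:
  assumes [measurable]: "f \<in> borel_measurable M" "g \<in> borel_measurable M"
  shows "(\<lambda>x. cis (- (f x \<bullet> (g x :: 'a::euclidean_space)))) \<in> borel_measurable M"
  unfolding cis_conv_exp by measurable

lemma borel_measurable_cnj [measurable]: "cnj \<in> borel_measurable borel"
  by (intro borel_measurable_continuous_onI continuous_intros)

lemma ft_measurable:
  assumes "prob_space P" and [measurable_cong]: "sets P = sets borel"
  shows "ft P \<in> borel_measurable borel"
proof -
  interpret prob_space P by fact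
  show ?thesis unfolding ft_def by measurable
qed

lemma norm_ft_le_1:
  assumes "prob_space P"
  shows "cmod (ft P \<omega>) \<le> 1"
proof -
  interpret prob_space P by fact
  have "cmod (ft P \<omega>) \<le> (LINT x|P. cmod (cis (- (x \<bullet> \<omega>))))"
    unfolding ft_def by (rule integral_norm_bound)
  then show ?thesis by (simp add: prob_space)
qed

lemma cmod_ft_diff_sq_le:
  assumes "prob_space P" "prob_space Q"
  shows "(cmod (ft P \<omega> - ft Q \<omega>))\<^sup>2 \<le> 4"
proof -
  have "cmod (ft P \<omega> - ft Q \<omega>) \<le> 2"
    using norm_triangle_ineq4[of "ft P \<omega>" "ft Q \<omega>"] norm_ft_le_1[OF assms(1), of \<omega>]
      norm_ft_le_1[OF assms(2), of \<omega>] by linarith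
  then have "(cmod (ft P \<omega> - ft Q \<omega>))\<^sup>2 \<le> 2\<^sup>2"
    by (intro power_mono) auto
  then show ?thesis by simp
qed

text \<open>The product of transforms averages \<open>cis ((y - x) \<bullet> \<omega>)\<close> over
  \<open>P\<close> and \<open>Q\<close>. Integrating \<open>\<omega>\<close> first against the
  Gaussian weight leaves the kernel with \<open>t = s\<^sup>2 / 2\<close>.\<close>

lemma
  fixes P Q :: "'a::euclidean_space measure"
  assumes P: "prob_space P" and sP [measurable_cong]: "sets P = sets borel"
    and Q: "prob_space Q" and sQ [measurable_cong]: "sets Q = sets borel"
    and s: "0 < s"
  shows integrable_ft_ft_gauss:
      "integrable lborel (\<lambda>\<omega>. ft P \<omega> * cnj (ft Q \<omega>) * gauss s \<omega>)" (is ?I)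
    and integral_ft_ft_gauss:
      "(LINT \<omega>|lborel. ft P \<omega> * cnj (ft Q \<omega>) * gauss s \<omega>) = gauss_mean (s\<^sup>2 / 2) P Q" (is ?E)
proof -
  note [measurable] = ft_measurable[OF P sP] ft_measurable[OF Q sQ]
  show ?I
  proof (rule Bochner_Integration.integrable_bound[OF integrable_gauss[OF s]])
    show "AE \<omega> in lborel. norm (ft P \<omega> * cnj (ft Q \<omega>) * gauss s \<omega>) \<le> norm (gauss s \<omega>)"
      using norm_ft_le_1[OF P] norm_ft_le_1[OF Q]
      by (auto simp: norm_mult intro!: mult_left_le_one_le mult_le_one)
  qed measurable
  \<comment> \<open>With the Gaussian weight read as a probability measure, both interchanges are
    Fubini for bounded functions on products of probability spaces.\<close>
  define N where "N = density lborel (\<lambda>x::'a. ennreal (gauss s x))"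
  have N: "prob_space N" and [measurable_cong]: "sets N = sets borel"
    by (auto simp: N_def prob_space_gauss s)
  have int_N: "(LINT \<omega>|N. f \<omega>) = (LINT \<omega>|lborel. f \<omega> * gauss s \<omega>)"
    if [measurable]: "f \<in> borel_measurable borel" for f :: "'a \<Rightarrow> complex"
    unfolding N_def by (subst integral_density) (auto simp: scaleR_conv_of_real mult.commute)
  have "(LINT \<omega>|lborel. ft P \<omega> * cnj (ft Q \<omega>) * gauss s \<omega>) = (LINT \<omega>|N. ft P \<omega> * cnj (ft Q \<omega>))"
    by (subst int_N) auto
  also have "\<dots> = (LINT \<omega>|N. LINT x|P. cis (- (x \<bullet> \<omega>)) * cnj (ft Q \<omega>))"
    by (simp add: ft_def)
  also have "\<dots> = (LINT x|P. LINT \<omega>|N. cis (- (x \<bullet> \<omega>)) * cnj (ft Q \<omega>))"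
    using norm_ft_le_1[OF Q]
    by (intro Fubini_bounded_prob[OF P N, of _ 1]) (auto simp: norm_mult)
  also have "\<dots> = (LINT x|P. LINT \<omega>|N. LINT y|Q. cis (- (x \<bullet> \<omega>)) * cis (y \<bullet> \<omega>))"
  proof -
    have "cnj (ft Q \<omega>) = (LINT y|Q. cis (y \<bullet> \<omega>))" for \<omega>
      by (simp only: ft_def Bochner_Integration.integral_cnj[symmetric] cis_cnj minus_minus)
    then show ?thesis by simp
  qed
  also have "\<dots> = (LINT x|P. LINT y|Q. LINT \<omega>|N. cis (- (x \<bullet> \<omega>)) * cis (y \<bullet> \<omega>))"
    by (intro Bochner_Integration.integral_cong refl Fubini_bounded_prob[OF Q N, of _ 1])
       (auto simp: norm_mult)
  also have "\<dots> = (LINT x|P. LINT y|Q. complex_of_real (exp (- (s\<^sup>2 / 2) * (norm (x - y))\<^sup>2)))"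
  proof (intro Bochner_Integration.integral_cong refl)
    fix x y :: 'a
    have "(LINT \<omega>|N. cis (- (x \<bullet> \<omega>)) * cis (y \<bullet> \<omega>)) = (LINT \<omega>|N. cis ((y - x) \<bullet> \<omega>))"
      by (simp add: cis_mult inner_diff_left)
    also have "\<dots> = exp (- s\<^sup>2 * (norm (y - x))\<^sup>2 / 2)"
      by (subst int_N, measurable) (rule integral_gauss_cis[OF s])
    finally show "(LINT \<omega>|N. cis (- (x \<bullet> \<omega>)) * cis (y \<bullet> \<omega>))
        = complex_of_real (exp (- (s\<^sup>2 / 2) * (norm (x - y))\<^sup>2))"
      by (simp add: norm_minus_commute)
  qed
  also have "\<dots> = gauss_mean (s\<^sup>2 / 2) P Q"
    by (simp add: gauss_mean_def)
  finally show ?E .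
qed

lemma
  fixes P Q :: "'a::euclidean_space measure"
  assumes P: "prob_space P" "sets P = sets borel" and Q: "prob_space Q" "sets Q = sets borel"
    and s: "0 < s"
  shows integrable_ft_diff_gauss:
      "integrable lborel (\<lambda>\<omega>. (cmod (ft P \<omega> - ft Q \<omega>))\<^sup>2 * gauss s \<omega>)"
    and integral_ft_diff_gauss:
      "(LINT \<omega>|lborel. (cmod (ft P \<omega> - ft Q \<omega>))\<^sup>2 * gauss s \<omega>)
         = gauss_mean (s\<^sup>2 / 2) P P + gauss_mean (s\<^sup>2 / 2) Q Q - 2 * gauss_mean (s\<^sup>2 / 2) P Q"
proof -
  have re: "integrable lborel (\<lambda>\<omega>. Re (ft A \<omega> * cnj (ft B \<omega>) * gauss s \<omega>))"
    "(LINT \<omega>|lborel. Re (ft A \<omega> * cnj (ft B \<omega>) * gauss s \<omega>)) = gauss_mean (s\<^sup>2 / 2) A B"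
    if "prob_space A" "sets A = sets borel" "prob_space B" "sets B = sets borel"
    for A B :: "'a measure"
    by (rule integrable_Re integrable_ft_ft_gauss that s)+
      (simp only: integral_Re[OF integrable_ft_ft_gauss[OF that s]] integral_ft_ft_gauss[OF that s]
        Re_complex_of_real)
  have eq: "(cmod (ft P \<omega> - ft Q \<omega>))\<^sup>2 * gauss s \<omega>
      = Re (ft P \<omega> * cnj (ft P \<omega>) * gauss s \<omega>) + Re (ft Q \<omega> * cnj (ft Q \<omega>) * gauss s \<omega>)
        - 2 * Re (ft P \<omega> * cnj (ft Q \<omega>) * gauss s \<omega>)" for \<omega>
    unfolding cmod_power2 by (simp add: algebra_simps power2_eq_square)
  show "integrable lborel (\<lambda>\<omega>. (cmod (ft P \<omega> - ft Q \<omega>))\<^sup>2 * gauss s \<omega>)"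
    unfolding eq by (intro Bochner_Integration.integrable_add Bochner_Integration.integrable_diff
        integrable_mult_right re P Q)
  show "(LINT \<omega>|lborel. (cmod (ft P \<omega> - ft Q \<omega>))\<^sup>2 * gauss s \<omega>)
         = gauss_mean (s\<^sup>2 / 2) P P + gauss_mean (s\<^sup>2 / 2) Q Q - 2 * gauss_mean (s\<^sup>2 / 2) P Q"
    unfolding eq using re[OF P P] re[OF Q Q] re[OF P Q] by simp
qed

section \<open>The energy distance as a mixture of Gaussian kernel discrepancies\<close>

definition energy_weight :: "real \<Rightarrow> real \<Rightarrow> real" where
  "energy_weight \<gamma> t = indicator {0<..} t * t powr (- \<gamma> / 2 - 1)"

text \<open>In closed form this is \<open>- Gamma (- \<gamma> / 2)\<close> for
  \<open>0 < \<gamma> < 2\<close>; the integral form is convenient for comparison with an explicit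
  majorant.\<close>

definition energy_const :: "real \<Rightarrow> real" where
  "energy_const \<gamma> = (LINT t|lborel. energy_weight \<gamma> t * (1 - exp (- t)))"

lemma energy_weight_measurable [measurable]: "energy_weight \<gamma> \<in> borel_measurable borel"
  unfolding energy_weight_def by measurable

lemma energy_weight_nonneg [simp]: "0 \<le> energy_weight \<gamma> t"
  by (simp add: energy_weight_def)

lemma energy_weight_mult_nonneg: "0 \<le> energy_weight \<gamma> t * (1 - exp (- t))"
  by (simp add: energy_weight_def indicator_def)

lemma
  assumes \<gamma>: "0 < \<gamma>" "\<gamma> < 2"
  shows integrable_energy_const: "integrable lborel (\<lambda>t. energy_weight \<gamma> t * (1 - exp (- t)))"
    and energy_const_le: "energy_const \<gamma> \<le> 4 / (\<gamma> * (2 - \<gamma>))"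
    and energy_const_pos: "0 < energy_const \<gamma>"
proof -
  \<comment> \<open>Majorant from \<open>1 - exp (- t) \<le> min t 1\<close>. The first part
    converges because \<open>\<gamma> < 2\<close> and has integral
    \<open>2 / (2 - \<gamma>)\<close>, the second because \<open>\<gamma> > 0\<close> and has
    integral \<open>2 / \<gamma>\<close>.\<close>
  define h where "h t = (if t \<in> {0..1} then t powr (- \<gamma> / 2) else 0)
      + (if t \<in> {1..} then t powr (- \<gamma> / 2 - 1) else 0)"
    for t :: real
  have [measurable]: "h \<in> borel_measurable borel"
    unfolding h_def by measurable
  have h0: "0 \<le> h t" for t
    by (simp add: h_def)
  have "((\<lambda>t. t powr (- \<gamma> / 2)) has_integral 1 / (- \<gamma> / 2 + 1)) {0..1}"
    using has_integral_powr_from_0[of "- \<gamma> / 2" 1] \<gamma> by simp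
  moreover have "((\<lambda>t. t powr (- \<gamma> / 2 - 1)) has_integral - 1 / (- \<gamma> / 2)) {1..}"
    using has_integral_powr_to_inf[of "- \<gamma> / 2 - 1" 1] \<gamma> by simp
  ultimately have "(h has_integral 1 / (- \<gamma> / 2 + 1) + - 1 / (- \<gamma> / 2)) UNIV"
    unfolding h_def by (intro has_integral_add) (simp_all only: has_integral_restrict_UNIV)
  moreover have "1 / (- \<gamma> / 2 + 1) + - 1 / (- \<gamma> / 2) = 4 / (\<gamma> * (2 - \<gamma>))"
    using \<gamma> by (simp add: divide_simps)
  ultimately have nn_h: "(\<integral>\<^sup>+t. h t \<partial>lborel) = ennreal (4 / (\<gamma> * (2 - \<gamma>)))"
    by (intro nn_integral_has_integral_lborel) (auto simp: h0)
  have le: "energy_weight \<gamma> t * (1 - exp (- t)) \<le> h t" for t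
  proof (cases "0 < t")
    case True
    have e: "1 - exp (- t) \<le> t" "1 - exp (- t) \<le> 1"
      using exp_ge_add_one_self[of "- t"] by auto
    have "t powr (- \<gamma> / 2 - 1) * t = t powr (- \<gamma> / 2)"
      using True powr_mult_base[of t "- \<gamma> / 2 - 1"] by (simp add: mult.commute)
    moreover have "t powr (- \<gamma> / 2 - 1) * (1 - exp (- t)) \<le> t powr (- \<gamma> / 2 - 1) * t"
      "t powr (- \<gamma> / 2 - 1) * (1 - exp (- t)) \<le> t powr (- \<gamma> / 2 - 1) * 1"
      using e by (auto intro!: mult_left_mono simp del: mult_1_right)
    ultimately show ?thesis
      using True by (auto simp: h_def energy_weight_def indicator_def) (smt (verit) exp_gt_zero)
  qed (simp add: energy_weight_def h0)
  have int_h: "integrable lborel h" "(LINT t|lborel. h t) = 4 / (\<gamma> * (2 - \<gamma>))"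
    using nn_h \<gamma> by (auto simp: h0 integrable_iff_bounded integral_eq_nn_integral)
  show int: "integrable lborel (\<lambda>t. energy_weight \<gamma> t * (1 - exp (- t)))"
  proof (rule Bochner_Integration.integrable_bound[OF int_h(1)])
    show "AE t in lborel. norm (energy_weight \<gamma> t * (1 - exp (- t))) \<le> norm (h t)"
      by (rule AE_I2) (simp only: real_norm_def abs_of_nonneg[OF h0]
          abs_of_nonneg[OF energy_weight_mult_nonneg] le)
  qed measurable
  show "energy_const \<gamma> \<le> 4 / (\<gamma> * (2 - \<gamma>))"
    unfolding energy_const_def int_h(2)[symmetric]
    by (intro integral_mono int int_h le)
  \<comment> \<open>On the unit-length interval \<open>{1..2}\<close> the weight is smallest at 2
    and \<open>1 - exp (- t)\<close> is smallest at 1.\<close>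
  define c where "c = 2 powr (- \<gamma> / 2 - 1) * (1 - exp (- 1 :: real))"
  have "0 < c" by (simp add: c_def)
  also have "c = (LINT t|lborel. indicator {1..2::real} t * c)"
    by simp
  also have "\<dots> \<le> energy_const \<gamma>"
    unfolding energy_const_def
  proof (rule integral_mono)
    show "integrable lborel (\<lambda>t. indicator {1..2::real} t * c :: real)"
      by simp
    show "indicator {1..2::real} t * c \<le> energy_weight \<gamma> t * (1 - exp (- t))" for t
    proof (cases "t \<in> {1..2}")
      case True
      then have "c \<le> t powr (- \<gamma> / 2 - 1) * (1 - exp (- t))"
        unfolding c_def using \<gamma> by (intro mult_mono powr_mono2') auto
      then show ?thesis
        using True by (simp add: energy_weight_def)
    qed (simp add: energy_weight_mult_nonneg)
  qed (rule int)
  finally show "0 < energy_const \<gamma>" .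
qed

text \<open>Substituting \<open>a\<^sup>2 * t\<close> for \<open>t\<close> scales the measure and
  the weight together by \<open>a powr (- \<gamma>)\<close>. At \<open>a = 0\<close> both sides
  vanish, since \<open>0 powr \<gamma> = 0\<close>. Nonnegative integrals prepare the use of
  Tonelli.\<close>

lemma nn_integral_energy_weight:
  assumes \<gamma>: "0 < \<gamma>" "\<gamma> < 2" and a: "0 \<le> a"
  shows "(\<integral>\<^sup>+t. ennreal (energy_weight \<gamma> t * (1 - exp (- t * a\<^sup>2))) \<partial>lborel)
    = ennreal (energy_const \<gamma> * a powr \<gamma>)"
proof (cases "a = 0")
  case False
  with a have a: "0 < a" by simp
  have e: "ennreal (energy_const \<gamma>) = (\<integral>\<^sup>+t. ennreal (energy_weight \<gamma> t * (1 - exp (- t))) \<partial>lborel)"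
    unfolding energy_const_def
    by (rule nn_integral_eq_integral[symmetric])
       (auto intro!: integrable_energy_const \<gamma> simp: energy_weight_mult_nonneg)
  also have "\<dots> = ennreal \<bar>a\<^sup>2\<bar> * (\<integral>\<^sup>+t. ennreal (energy_weight \<gamma> (0 + a\<^sup>2 * t) * (1 - exp (- (0 + a\<^sup>2 * t)))) \<partial>lborel)"
    using a by (intro nn_integral_real_affine) auto
  also have "\<dots> = (\<integral>\<^sup>+t. ennreal (a powr (- \<gamma>)) * ennreal (energy_weight \<gamma> t * (1 - exp (- t * a\<^sup>2))) \<partial>lborel)"
  proof (subst nn_integral_cmult[symmetric], measurable, rule nn_integral_cong)
    fix t
    have "energy_weight \<gamma> (a\<^sup>2 * t) = (a\<^sup>2) powr (- \<gamma> / 2 - 1) * energy_weight \<gamma> t"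
      using a by (auto simp: energy_weight_def indicator_def powr_mult zero_less_mult_iff)
    moreover have "(a\<^sup>2) powr (- \<gamma> / 2 - 1) = a powr (- \<gamma> - 2)"
      using a powr_powr[of a 2 "- \<gamma> / 2 - 1"] by (simp add: algebra_simps)
    moreover have "a\<^sup>2 * a powr (- \<gamma> - 2) = a powr (- \<gamma>)"
      using a powr_add[of a 2 "- \<gamma> - 2"] by simp
    ultimately have "\<bar>a\<^sup>2\<bar> * (energy_weight \<gamma> (0 + a\<^sup>2 * t) * (1 - exp (- (0 + a\<^sup>2 * t))))
       = a powr (- \<gamma>) * (energy_weight \<gamma> t * (1 - exp (- t * a\<^sup>2)))"
      by (simp add: mult.assoc[symmetric] mult.commute[of t])
    then show "ennreal \<bar>a\<^sup>2\<bar> * ennreal (energy_weight \<gamma> (0 + a\<^sup>2 * t) * (1 - exp (- (0 + a\<^sup>2 * t))))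
       = ennreal (a powr (- \<gamma>)) * ennreal (energy_weight \<gamma> t * (1 - exp (- t * a\<^sup>2)))"
      by (metis abs_ge_zero ennreal_mult' powr_ge_zero)
  qed
  also have "\<dots> = ennreal (a powr (- \<gamma>)) * (\<integral>\<^sup>+t. ennreal (energy_weight \<gamma> t * (1 - exp (- t * a\<^sup>2))) \<partial>lborel)"
    by (rule nn_integral_cmult) measurable
  finally have *: "ennreal (energy_const \<gamma>) = \<dots>" .
  have "ennreal (energy_const \<gamma> * a powr \<gamma>) = ennreal (a powr \<gamma>) * ennreal (energy_const \<gamma>)"
    using energy_const_pos[OF \<gamma>] by (simp add: ennreal_mult'' mult.commute)
  also have "\<dots> = ennreal (a powr \<gamma> * a powr (- \<gamma>)) *
      (\<integral>\<^sup>+t. ennreal (energy_weight \<gamma> t * (1 - exp (- t * a\<^sup>2))) \<partial>lborel)"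
    unfolding * by (simp add: ennreal_mult mult.assoc)
  also have "a powr \<gamma> * a powr (- \<gamma>) = 1"
    using a by (simp flip: powr_add)
  finally show ?thesis by simp
qed simp

section \<open>Product measures and integrability of moments\<close>

lemma distr_pair_snd:
  assumes "prob_space M" "prob_space N"
  shows "distr (M \<Otimes>\<^sub>M N) N snd = N"
proof (rule measure_eqI)
  interpret M: prob_space M by fact
  interpret N: prob_space N by fact
  fix A assume "A \<in> sets (distr (M \<Otimes>\<^sub>M N) N snd)"
  then have A: "A \<in> sets N" by simp
  then have "snd -` A \<inter> space (M \<Otimes>\<^sub>M N) = space M \<times> A"
    using sets.sets_into_space[OF A] by (auto simp: space_pair_measure)
  with A show "emeasure (distr (M \<Otimes>\<^sub>M N) N snd) A = emeasure N A"
    by (simp add: emeasure_distr N.emeasure_pair_measure_Times M.emeasure_space_1)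
qed simp

lemma gauss_mean_eq_pair:
  assumes P: "prob_space P" and [measurable_cong]: "sets P = sets borel"
    and Q: "prob_space Q" and [measurable_cong]: "sets Q = sets borel" and t: "0 \<le> t"
  shows "gauss_mean t P Q = (LINT z|(P \<Otimes>\<^sub>M Q). exp (- t * (norm (fst z - snd z))\<^sup>2))"
proof -
  interpret M1: prob_space P by fact
  interpret M2: prob_space Q by fact
  interpret PQ: pair_prob_space P Q ..
  have "integrable (P \<Otimes>\<^sub>M Q) (\<lambda>z. exp (- t * (norm (fst z - snd z))\<^sup>2))"
    by (rule integrable_bounded_prob[of _ _ 1]) (use t in \<open>auto simp: PQ.prob_space_axioms\<close>)
  from PQ.integral_fst'[OF this] show ?thesis
    by (simp add: gauss_mean_def)
qed

text \<open>Second moments suffice by \<open>u powr \<gamma> \<le> 1 + u^2\<close>. This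
  integrability is what permits splitting the energy distance into separate integrals.\<close>

lemma integrable_norm_diff_powr:
  fixes P Q :: "'a::euclidean_space measure"
  assumes P: "prob_space P" and sP[measurable_cong]: "sets P = sets borel"
    and Q: "prob_space Q" and sQ[measurable_cong]: "sets Q = sets borel"
    and mP: "integrable P (\<lambda>x. (norm x)\<^sup>2)" and mQ: "integrable Q (\<lambda>x. (norm x)\<^sup>2)"
    and \<gamma>: "0 < \<gamma>" "\<gamma> < 2"
  shows "integrable (P \<Otimes>\<^sub>M Q) (\<lambda>z. norm (fst z - snd z) powr \<gamma>)"
proof -
  interpret M1: prob_space P by fact
  interpret M2: prob_space Q by fact
  interpret PQ: pair_prob_space P Q ..
  have 1: "integrable (P \<Otimes>\<^sub>M Q) (\<lambda>z. (norm (fst z))\<^sup>2)"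
    using mP integrable_distr_eq[of fst "P \<Otimes>\<^sub>M Q" P "\<lambda>x. (norm x)\<^sup>2"]
    by (simp add: M2.distr_pair_fst)
  have 2: "integrable (P \<Otimes>\<^sub>M Q) (\<lambda>z. (norm (snd z))\<^sup>2)"
    using mQ integrable_distr_eq[of snd "P \<Otimes>\<^sub>M Q" Q "\<lambda>x. (norm x)\<^sup>2"]
    by (simp add: distr_pair_snd P Q)
  have "integrable (P \<Otimes>\<^sub>M Q) (\<lambda>z. 1 + 2 * (norm (fst z))\<^sup>2 + 2 * (norm (snd z))\<^sup>2)"
    using 1 2 by auto
  then show ?thesis
  proof (rule Bochner_Integration.integrable_bound)
    show "AE z in P \<Otimes>\<^sub>M Q. norm (norm (fst z - snd z) powr \<gamma>)
        \<le> norm (1 + 2 * (norm (fst z))\<^sup>2 + 2 * (norm (snd z))\<^sup>2)"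
    proof (rule AE_I2)
      fix z :: "'a \<times> 'a"
      define u where "u = norm (fst z - snd z)"
      have "u powr \<gamma> \<le> 1 + u\<^sup>2"
      proof (cases "u \<le> 1")
        case True
        then have "u powr \<gamma> \<le> 1" using \<gamma> by (intro powr_le1) (auto simp: u_def)
        then show ?thesis using zero_le_power2[of u] by linarith
      next
        case False
        then have "u powr \<gamma> \<le> u powr 2" using \<gamma> by (intro powr_mono) auto
        then show ?thesis using False by simp
      qed
      moreover have "u\<^sup>2 \<le> (norm (fst z) + norm (snd z))\<^sup>2"
        unfolding u_def by (intro power_mono norm_triangle_ineq4) auto
      moreover have "\<dots> \<le> 2 * (norm (fst z))\<^sup>2 + 2 * (norm (snd z))\<^sup>2"
        using zero_le_power2[of "norm (fst z) - norm (snd z)"] by (simp add: power2_eq_square algebra_simps)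
      ultimately show "norm (norm (fst z - snd z) powr \<gamma>)
        \<le> norm (1 + 2 * (norm (fst z))\<^sup>2 + 2 * (norm (snd z))\<^sup>2)"
        by (simp only: u_def[symmetric] real_norm_def abs_of_nonneg powr_ge_zero)
    qed
  qed measurable
qed

text \<open>\<open>nn_integral_energy_weight\<close> is averaged over \<open>a = |x - y|\<close> and
  the integrals are swapped by Tonelli; the finite moment on the other side then yields
  integrability in \<open>t\<close>. The difference \<open>1 - gauss_mean\<close> must stay
  together, because the weight alone is not integrable at 0.\<close>

lemma
  fixes P Q :: "'a::euclidean_space measure"
  assumes P: "prob_space P" and sP[measurable_cong]: "sets P = sets borel"
    and Q: "prob_space Q" and sQ[measurable_cong]: "sets Q = sets borel"
    and mP: "integrable P (\<lambda>x. (norm x)\<^sup>2)" and mQ: "integrable Q (\<lambda>x. (norm x)\<^sup>2)"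
    and \<gamma>: "0 < \<gamma>" "\<gamma> < 2"
  shows integrable_energy_weight_gauss_mean:
      "integrable lborel (\<lambda>t. energy_weight \<gamma> t * (1 - gauss_mean t P Q))" (is ?I)
    and integral_energy_weight_gauss_mean:
      "(LINT t|lborel. energy_weight \<gamma> t * (1 - gauss_mean t P Q))
        = energy_const \<gamma> * (LINT z|(P \<Otimes>\<^sub>M Q). norm (fst z - snd z) powr \<gamma>)" (is ?E)
proof -
  interpret M1: prob_space P by fact
  interpret M2: prob_space Q by fact
  interpret PQ: pair_prob_space P Q ..
  interpret L: pair_sigma_finite "P \<Otimes>\<^sub>M Q" lborel ..
  have [measurable]: "(\<lambda>t. gauss_mean t P Q) \<in> borel_measurable borel"
    unfolding gauss_mean_def by measurable
  have gauss_mean_le_1: "gauss_mean t P Q \<le> 1" if "0 \<le> t" for t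
    unfolding gauss_mean_eq_pair[OF P sP Q sQ that]
    by (rule PQ.integral_le_const) (use that in \<open>auto intro!: integrable_bounded_prob[of _ _ 1] PQ.prob_space_axioms\<close>)
  have nn: "0 \<le> energy_weight \<gamma> t * (1 - gauss_mean t P Q)" for t
    using gauss_mean_le_1[of t] by (simp add: energy_weight_def indicator_def)
  note int = integrable_norm_diff_powr[OF P sP Q sQ mP mQ \<gamma>]
  have "ennreal (energy_const \<gamma> * (LINT z|(P \<Otimes>\<^sub>M Q). norm (fst z - snd z) powr \<gamma>))
      = (\<integral>\<^sup>+z. ennreal (energy_const \<gamma> * norm (fst z - snd z) powr \<gamma>) \<partial>(P \<Otimes>\<^sub>M Q))"
    using energy_const_pos[OF \<gamma>] int by (subst nn_integral_eq_integral) auto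
  also have "\<dots> = (\<integral>\<^sup>+z. \<integral>\<^sup>+t. ennreal (energy_weight \<gamma> t * (1 - exp (- t * (norm (fst z - snd z))\<^sup>2))) \<partial>lborel \<partial>(P \<Otimes>\<^sub>M Q))"
    by (intro nn_integral_cong nn_integral_energy_weight[symmetric] \<gamma>) auto
  also have "\<dots> = (\<integral>\<^sup>+t. \<integral>\<^sup>+z. ennreal (energy_weight \<gamma> t * (1 - exp (- t * (norm (fst z - snd z))\<^sup>2))) \<partial>(P \<Otimes>\<^sub>M Q) \<partial>lborel)"
    by (rule L.Fubini'[symmetric]) measurable
  also have "\<dots> = (\<integral>\<^sup>+t. ennreal (energy_weight \<gamma> t * (1 - gauss_mean t P Q)) \<partial>lborel)"
  proof (rule nn_integral_cong)
    fix t :: real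
    show "(\<integral>\<^sup>+z. ennreal (energy_weight \<gamma> t * (1 - exp (- t * (norm (fst z - snd z))\<^sup>2))) \<partial>(P \<Otimes>\<^sub>M Q))
        = ennreal (energy_weight \<gamma> t * (1 - gauss_mean t P Q))"
    proof (cases "0 < t")
      case True
      have i: "integrable (P \<Otimes>\<^sub>M Q) (\<lambda>z. exp (- t * (norm (fst z - snd z))\<^sup>2))"
        by (rule integrable_bounded_prob[of _ _ 1]) (use True in \<open>auto simp: PQ.prob_space_axioms\<close>)
      then have "(\<integral>\<^sup>+z. ennreal (energy_weight \<gamma> t * (1 - exp (- t * (norm (fst z - snd z))\<^sup>2))) \<partial>(P \<Otimes>\<^sub>M Q))
        = ennreal (LINT z|(P \<Otimes>\<^sub>M Q). energy_weight \<gamma> t * (1 - exp (- t * (norm (fst z - snd z))\<^sup>2)))"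
        using True by (intro nn_integral_eq_integral) auto
      also have "(LINT z|(P \<Otimes>\<^sub>M Q). energy_weight \<gamma> t * (1 - exp (- t * (norm (fst z - snd z))\<^sup>2)))
         = energy_weight \<gamma> t * (1 - gauss_mean t P Q)"
        using i True by (simp add: gauss_mean_eq_pair[OF P sP Q sQ] PQ.prob_space)
      finally show ?thesis .
    qed (simp add: energy_weight_def)
  qed
  finally have *: "(\<integral>\<^sup>+t. ennreal (energy_weight \<gamma> t * (1 - gauss_mean t P Q)) \<partial>lborel)
     = ennreal (energy_const \<gamma> * (LINT z|(P \<Otimes>\<^sub>M Q). norm (fst z - snd z) powr \<gamma>))" by simp
  show ?I
    using * nn by (auto simp: integrable_iff_bounded)
  have "0 \<le> energy_const \<gamma> * (LINT z|(P \<Otimes>\<^sub>M Q). norm (fst z - snd z) powr \<gamma>)"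
    using energy_const_pos[OF \<gamma>] by (auto intro!: mult_nonneg_nonneg)
  then show ?E
    using * nn by (subst integral_eq_nn_integral) (auto simp del: ennreal_mult)
qed

lemma integral_distr_lift:
  assumes "f \<in> measurable M N" "distr M N f = N" "integrable N (g :: _ \<Rightarrow> real)"
  shows "integrable M (\<lambda>x. g (f x))" "(LINT x|M. g (f x)) = (LINT x|N. g x)"
  using assms integrable_distr_eq[of f M N g] integral_distr[of f M N g] by auto

text \<open>Each of the three terms involves only two of the four independent variables, so each is
  an integral over the corresponding marginal.\<close>

lemma energy_distance_eq:
  fixes \<mu> \<nu> :: "'a::euclidean_space measure"
  assumes \<mu>: "prob_space \<mu>" and s\<mu>[measurable_cong]: "sets \<mu> = sets borel"
    and \<nu>: "prob_space \<nu>" and s\<nu>[measurable_cong]: "sets \<nu> = sets borel"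
    and m\<mu>: "integrable \<mu> (\<lambda>x. (norm x)\<^sup>2)" and m\<nu>: "integrable \<nu> (\<lambda>x. (norm x)\<^sup>2)"
    and \<gamma>: "0 < \<gamma>" "\<gamma> < 2"
  shows "energy_distance \<gamma> \<mu> \<nu> = sqrt (2 * (LINT z|(\<mu> \<Otimes>\<^sub>M \<nu>). norm (fst z - snd z) powr \<gamma>)
     - (LINT z|(\<mu> \<Otimes>\<^sub>M \<mu>). norm (fst z - snd z) powr \<gamma>)
     - (LINT z|(\<nu> \<Otimes>\<^sub>M \<nu>). norm (fst z - snd z) powr \<gamma>))"
proof -
  interpret M1: prob_space \<mu> by fact
  interpret M2: prob_space \<nu> by fact
  interpret M11: pair_prob_space \<mu> \<mu> ..
  interpret M22: pair_prob_space \<nu> \<nu> ..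
  interpret M12: pair_prob_space \<mu> \<nu> ..
  let ?M = "(\<mu> \<Otimes>\<^sub>M \<mu>) \<Otimes>\<^sub>M (\<nu> \<Otimes>\<^sub>M \<nu>)"
  let ?g = "\<lambda>z. norm (fst z - snd z :: 'a) powr \<gamma>"
  have 1: "distr ?M (\<mu> \<Otimes>\<^sub>M \<mu>) fst = \<mu> \<Otimes>\<^sub>M \<mu>"
    by (rule M22.distr_pair_fst)
  have 2: "distr ?M (\<nu> \<Otimes>\<^sub>M \<nu>) snd = \<nu> \<Otimes>\<^sub>M \<nu>"
    by (rule distr_pair_snd) (rule M11.prob_space_axioms M22.prob_space_axioms)+
  have 3: "distr ?M (\<mu> \<Otimes>\<^sub>M \<nu>) (\<lambda>(x, y). (fst x, fst y)) = \<mu> \<Otimes>\<^sub>M \<nu>"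
  proof -
    have d: "distr (\<mu> \<Otimes>\<^sub>M \<mu>) \<mu> fst = \<mu>" "distr (\<nu> \<Otimes>\<^sub>M \<nu>) \<nu> fst = \<nu>"
      by (rule M1.distr_pair_fst M2.distr_pair_fst)+
    have "distr (\<mu> \<Otimes>\<^sub>M \<mu>) \<mu> fst \<Otimes>\<^sub>M distr (\<nu> \<Otimes>\<^sub>M \<nu>) \<nu> fst = distr ?M (\<mu> \<Otimes>\<^sub>M \<nu>) (\<lambda>(x, y). (fst x, fst y))"
      by (rule pair_measure_distr) (auto simp: d M2.sigma_finite_measure_axioms)
    then show ?thesis by (simp add: d)
  qed
  note i = integrable_norm_diff_powr[OF _ _ _ _ _ _ \<gamma>]
  have m3: "(\<lambda>(x, y). (fst x, fst y)) \<in> measurable ?M (\<mu> \<Otimes>\<^sub>M \<nu>)" by measurable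
  note l1 = integral_distr_lift[OF measurable_fst 1 i[OF \<mu> s\<mu> \<mu> s\<mu> m\<mu> m\<mu>]]
  note l2 = integral_distr_lift[OF measurable_snd 2 i[OF \<nu> s\<nu> \<nu> s\<nu> m\<nu> m\<nu>]]
  note l3 = integral_distr_lift[OF m3 3 i[OF \<mu> s\<mu> \<nu> s\<nu> m\<mu> m\<nu>]]
  have "(LINT ((x, x'), (y, y'))|?M. 2 * norm (x - y) powr \<gamma> - norm (x - x') powr \<gamma> - norm (y - y') powr \<gamma>)
    = (LINT z|?M. 2 * ?g (case z of (x, y) \<Rightarrow> (fst x, fst y)) - ?g (fst z) - ?g (snd z))"
    by (intro Bochner_Integration.integral_cong) (auto simp: split_beta)
  also have "\<dots> = 2 * (LINT z|(\<mu> \<Otimes>\<^sub>M \<nu>). ?g z) - (LINT z|(\<mu> \<Otimes>\<^sub>M \<mu>). ?g z) - (LINT z|(\<nu> \<Otimes>\<^sub>M \<nu>). ?g z)"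
    unfolding l1(2)[symmetric] l2(2)[symmetric] l3(2)[symmetric]
    using l1(1) l2(1) l3(1) by simp
  finally show ?thesis
    by (simp add: energy_distance_def)
qed

section \<open>Low frequencies against the energy distance\<close>

lemma integrable_indicator_cball_ft_diff:
  fixes \<mu> \<nu> :: "'a::euclidean_space measure"
  assumes \<mu>: "prob_space \<mu>" "sets \<mu> = sets borel" and \<nu>: "prob_space \<nu>" "sets \<nu> = sets borel"
  shows "integrable lborel (\<lambda>\<omega>. indicator (cball 0 R) \<omega> * (cmod (ft \<mu> \<omega> - ft \<nu> \<omega>))\<^sup>2)"
proof (rule Bochner_Integration.integrable_bound)
  note [measurable] = ft_measurable[OF \<mu>] ft_measurable[OF \<nu>]
  show "integrable lborel (\<lambda>\<omega>::'a. indicator (cball 0 R) \<omega> * 4 :: real)"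
    using emeasure_bounded_finite[OF bounded_cball, of "0::'a" R]
    by (intro integrable_mult_left integrable_real_indicator) auto
  show "(\<lambda>\<omega>. indicator (cball 0 R) \<omega> * (cmod (ft \<mu> \<omega> - ft \<nu> \<omega>))\<^sup>2) \<in> borel_measurable lborel"
    by (intro borel_measurable_times borel_measurable_indicator) (simp, measurable)
  show "AE \<omega> in lborel. norm (indicator (cball 0 R) \<omega> * (cmod (ft \<mu> \<omega> - ft \<nu> \<omega>))\<^sup>2)
      \<le> norm (indicator (cball 0 R) \<omega> * 4 :: real)"
    using cmod_ft_diff_sq_le[OF \<mu>(1) \<nu>(1)] by (auto simp: indicator_def)
qed

text \<open>Nonnegativity falls out of the same estimate: the truncated integral is nonnegative,
  hence so is the quantity under the root, and \<open>sqrt\<close> may be squared back. Any radius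
  \<open>R\<close> does for this.\<close>

lemma
  fixes \<mu> \<nu> :: "'a::euclidean_space measure"
  assumes \<mu>: "prob_space \<mu>" and s\<mu>[measurable_cong]: "sets \<mu> = sets borel"
    and \<nu>: "prob_space \<nu>" and s\<nu>[measurable_cong]: "sets \<nu> = sets borel"
    and m\<mu>: "integrable \<mu> (\<lambda>x. (norm x)\<^sup>2)" and m\<nu>: "integrable \<nu> (\<lambda>x. (norm x)\<^sup>2)"
    and \<gamma>: "0 < \<gamma>" "\<gamma> < 2" and R: "0 < R"
  shows energy_distance_nonneg: "0 \<le> energy_distance \<gamma> \<mu> \<nu>"
    and ft_diff_ball_le_energy_distance:
      "\<gamma> * (2 - \<gamma>) * (LINT \<omega>|lborel. indicator (cball 0 R) \<omega> * (cmod (ft \<mu> \<omega> - ft \<nu> \<omega>))\<^sup>2)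
        \<le> 16 * exp (1 / 4) * (8 * pi) powr (real DIM('a) / 2) * R powr (real DIM('a) + \<gamma>)
            * (energy_distance \<gamma> \<mu> \<nu>)\<^sup>2"
proof -
  define E2 where "E2 = 2 * (LINT z|(\<mu> \<Otimes>\<^sub>M \<nu>). norm (fst z - snd z) powr \<gamma>)
     - (LINT z|(\<mu> \<Otimes>\<^sub>M \<mu>). norm (fst z - snd z) powr \<gamma>)
     - (LINT z|(\<nu> \<Otimes>\<^sub>M \<nu>). norm (fst z - snd z) powr \<gamma>)"
  define D where "D \<omega> = (cmod (ft \<mu> \<omega> - ft \<nu> \<omega>))\<^sup>2" for \<omega>
  define I where "I = (LINT \<omega>|lborel. indicator (cball 0 R) \<omega> * D \<omega>)"
  define d where "d = real DIM('a)"
  note [measurable] = ft_measurable[OF \<mu> s\<mu>] ft_measurable[OF \<nu> s\<nu>]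
  have [measurable]: "D \<in> borel_measurable borel"
    unfolding D_def by measurable
  have D: "0 \<le> D \<omega>" "D \<omega> \<le> 4" for \<omega>
    using cmod_ft_diff_sq_le[OF \<mu> \<nu>] by (auto simp: D_def)
  have int_ball: "integrable lborel (\<lambda>\<omega>::'a. indicator (cball 0 R) \<omega> * D \<omega>)"
    unfolding D_def by (rule integrable_indicator_cball_ft_diff[OF \<mu> s\<mu> \<nu> s\<nu>])
  have I0: "0 \<le> I"
    unfolding I_def by (rule Bochner_Integration.integral_nonneg) (simp add: D)
  define G where "G t = gauss_mean t \<mu> \<mu> + gauss_mean t \<nu> \<nu> - 2 * gauss_mean t \<mu> \<nu>" for t
  have G: "integrable lborel (\<lambda>\<omega>. D \<omega> * gauss (sqrt (2 * t)) \<omega>)"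
      "G t = (LINT \<omega>|lborel. D \<omega> * gauss (sqrt (2 * t)) \<omega>)" if "0 < t" for t
    using integrable_ft_diff_gauss[OF \<mu> s\<mu> \<nu> s\<nu>, of "sqrt (2 * t)"]
      integral_ft_diff_gauss[OF \<mu> s\<mu> \<nu> s\<nu>, of "sqrt (2 * t)"] that by (auto simp: D_def G_def)
  have G0: "0 \<le> energy_weight \<gamma> t * G t" for t
    by (cases "0 < t") (auto simp: G energy_weight_def D intro!: mult_nonneg_nonneg Bochner_Integration.integral_nonneg)
  note i = integrable_energy_weight_gauss_mean[OF _ _ _ _ _ _ \<gamma>]
    and e = integral_energy_weight_gauss_mean[OF _ _ _ _ _ _ \<gamma>]
  note i12 = i[OF \<mu> s\<mu> \<nu> s\<nu> m\<mu> m\<nu>] and i11 = i[OF \<mu> s\<mu> \<mu> s\<mu> m\<mu> m\<mu>] and i22 = i[OF \<nu> s\<nu> \<nu> s\<nu> m\<nu> m\<nu>]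
  note e12 = e[OF \<mu> s\<mu> \<nu> s\<nu> m\<mu> m\<nu>] and e11 = e[OF \<mu> s\<mu> \<mu> s\<mu> m\<mu> m\<mu>] and e22 = e[OF \<nu> s\<nu> \<nu> s\<nu> m\<nu> m\<nu>]
  \<comment> \<open>The constants 1 cancel as \<open>2 - 1 - 1\<close>, so three convergent
    integrals recombine into one over \<open>G\<close>.\<close>
  have Geq: "energy_weight \<gamma> t * G t = 2 * (energy_weight \<gamma> t * (1 - gauss_mean t \<mu> \<nu>))
      - energy_weight \<gamma> t * (1 - gauss_mean t \<mu> \<mu>) - energy_weight \<gamma> t * (1 - gauss_mean t \<nu> \<nu>)" for t
    by (simp add: G_def algebra_simps)
  have iG: "integrable lborel (\<lambda>t. energy_weight \<gamma> t * G t)"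
    unfolding Geq using i12 i11 i22 by simp
  have "(LINT t|lborel. energy_weight \<gamma> t * G t)
      = 2 * (LINT t|lborel. energy_weight \<gamma> t * (1 - gauss_mean t \<mu> \<nu>))
        - (LINT t|lborel. energy_weight \<gamma> t * (1 - gauss_mean t \<mu> \<mu>))
        - (LINT t|lborel. energy_weight \<gamma> t * (1 - gauss_mean t \<nu> \<nu>))"
    unfolding Geq using i12 i11 i22 by simp
  then have "(LINT t|lborel. energy_weight \<gamma> t * G t) = energy_const \<gamma> * E2"
    unfolding e12 e11 e22 by (simp add: E2_def algebra_simps)
  \<comment> \<open>Lower bound for \<open>gauss (sqrt (2 * t))\<close> on the ball of radius
    \<open>R\<close>: \<open>t \<le> 2 * R\<^sup>2\<close> bounds the normalising factor from below,
    and \<open>t \<ge> R\<^sup>2\<close> keeps the exponent \<open>|\<omega>|^2 / (4 * t)\<close> at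
    most \<open>1 / 4\<close>.\<close>
  moreover define c where "c = (8 * pi * R\<^sup>2) powr (- d / 2) * exp (- 1 / 4)"
  have "(LINT t|lborel. indicator {R\<^sup>2..2 * R\<^sup>2} t * ((2 * R\<^sup>2) powr (- \<gamma> / 2 - 1) * (c * I)))
      \<le> (LINT t|lborel. energy_weight \<gamma> t * G t)"
  proof (rule integral_mono)
    fix t
    show "indicator {R\<^sup>2..2 * R\<^sup>2} t * ((2 * R\<^sup>2) powr (- \<gamma> / 2 - 1) * (c * I)) \<le> energy_weight \<gamma> t * G t"
    proof (cases "t \<in> {R\<^sup>2..2 * R\<^sup>2}")
      case True
      have t: "0 < t" using True R by (auto intro: less_le_trans[of 0 "R\<^sup>2"])
      have "c * I = (LINT \<omega>|lborel. (indicator (cball 0 R) \<omega> * D \<omega>) * c)"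
        by (simp add: I_def mult.commute)
      also have "\<dots> \<le> (LINT \<omega>|lborel. D \<omega> * gauss (sqrt (2 * t)) \<omega>)"
      proof (rule integral_mono)
        fix \<omega> :: 'a
        show "indicator (cball 0 R) \<omega> * D \<omega> * c \<le> D \<omega> * gauss (sqrt (2 * t)) \<omega>"
        proof (cases "norm \<omega> \<le> R")
          case in_ball: True
          have "(norm \<omega>)\<^sup>2 \<le> t"
            using in_ball True power_mono[of "norm \<omega>" R 2] by auto
          then have "- 1 / 4 \<le> - (norm \<omega>)\<^sup>2 / (2 * (sqrt (2 * t))\<^sup>2)"
            using t by (simp add: divide_simps)
          moreover have "(8 * pi * R\<^sup>2) powr (- d / 2) \<le> (2 * pi * (sqrt (2 * t))\<^sup>2) powr (- d / 2)"
            using t True by (intro powr_mono2') (auto simp: d_def)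
          ultimately have "c \<le> gauss (sqrt (2 * t)) \<omega>"
            unfolding c_def gauss_def d_def by (intro mult_mono) auto
          then show ?thesis
            using in_ball D by (auto intro!: mult_left_mono)
        qed (simp add: D)
      qed (use int_ball G t in auto)
      also have "\<dots> = G t" using G t by simp
      finally have "c * I \<le> G t" .
      moreover have "(2 * R\<^sup>2) powr (- \<gamma> / 2 - 1) \<le> t powr (- \<gamma> / 2 - 1)"
        using True t \<gamma> by (intro powr_mono2') auto
      moreover have "0 \<le> c * I" using I0 by (simp add: c_def)
      ultimately have "(2 * R\<^sup>2) powr (- \<gamma> / 2 - 1) * (c * I) \<le> t powr (- \<gamma> / 2 - 1) * G t"
        by (intro mult_mono) auto
      then show ?thesis using True t by (simp add: energy_weight_def)
    qed (simp add: G0)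
  qed (use iG in auto)
  moreover have "(LINT t|lborel. indicator {R\<^sup>2..2 * R\<^sup>2} t * ((2 * R\<^sup>2) powr (- \<gamma> / 2 - 1) * (c * I)))
      = R\<^sup>2 * ((2 * R\<^sup>2) powr (- \<gamma> / 2 - 1) * (c * I))"
    by simp
  ultimately have main: "R\<^sup>2 * ((2 * R\<^sup>2) powr (- \<gamma> / 2 - 1) * (c * I)) \<le> energy_const \<gamma> * E2"
    by simp
  have pos: "0 \<le> R\<^sup>2 * ((2 * R\<^sup>2) powr (- \<gamma> / 2 - 1) * (c * I))"
    using I0 by (simp add: c_def)
  have E2: "0 \<le> E2"
    using order_trans[OF pos main] energy_const_pos[OF \<gamma>] by (simp add: zero_le_mult_iff)
  have ed: "energy_distance \<gamma> \<mu> \<nu> = sqrt E2"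
    unfolding E2_def by (rule energy_distance_eq[OF \<mu> s\<mu> \<nu> s\<nu> m\<mu> m\<nu> \<gamma>])
  show "0 \<le> energy_distance \<gamma> \<mu> \<nu>"
    using E2 by (simp add: ed)
  have "energy_const \<gamma> * E2 \<le> 4 / (\<gamma> * (2 - \<gamma>)) * E2"
    using E2 by (intro mult_right_mono energy_const_le \<gamma>)
  with main have "\<gamma> * (2 - \<gamma>) * (R\<^sup>2 * ((2 * R\<^sup>2) powr (- \<gamma> / 2 - 1) * (c * I)))
      \<le> \<gamma> * (2 - \<gamma>) * (4 / (\<gamma> * (2 - \<gamma>)) * E2)"
    using \<gamma> by (intro mult_left_mono) auto
  then have m2: "\<gamma> * (2 - \<gamma>) * (R\<^sup>2 * ((2 * R\<^sup>2) powr (- \<gamma> / 2 - 1) * (c * I))) \<le> 4 * E2"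
    using \<gamma> by simp
  have RR: "(R\<^sup>2) powr p = R powr (2 * p)" for p
    using R powr_powr[of R 2 p] by simp
  have "R\<^sup>2 * ((2 * R\<^sup>2) powr (- \<gamma> / 2 - 1) * c)
      = 2 powr (- \<gamma> / 2 - 1) * exp (- 1 / 4) * (8 * pi) powr (- d / 2) * (R\<^sup>2 * R powr (- \<gamma> - 2) * R powr (- d))"
    using R by (simp add: c_def powr_mult RR algebra_simps)
  also have "R\<^sup>2 * R powr (- \<gamma> - 2) * R powr (- d) = R powr (- (d + \<gamma>))"
    using R powr_add[of R 2 "- \<gamma> - 2"] powr_add[of R "- d" "- \<gamma>"] by (simp add: mult.commute)
  also have "2 powr (- \<gamma> / 2 - 1) * exp (- 1 / 4) * (8 * pi) powr (- d / 2) * R powr (- (d + \<gamma>))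
     \<ge> 1 / 4 * exp (- 1 / 4) * (8 * pi) powr (- d / 2) * R powr (- (d + \<gamma>))"
  \<comment> \<open>Here \<open>\<gamma> < 2\<close> removes \<open>\<gamma>\<close> from the
    constant. This \<open>1 / 4\<close> and the 4 bounding the mixture constant make up the 16 of
    the statement.\<close>
  proof (intro mult_right_mono)
    have "(2::real) powr (- 2) \<le> 2 powr (- \<gamma> / 2 - 1)"
      using \<gamma> by (intro powr_mono) auto
    then show "1 / 4 \<le> (2::real) powr (- \<gamma> / 2 - 1)"
      by (simp add: powr_minus)
  qed auto
  also have "1 / 4 * exp (- 1 / 4) * (8 * pi) powr (- d / 2) * R powr (- (d + \<gamma>))
      = 1 / (4 * exp (1 / 4) * (8 * pi) powr (d / 2) * R powr (d + \<gamma>))"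
    by (simp only: powr_minus exp_minus minus_divide_left[symmetric] inverse_eq_divide) simp
  finally have cc: "1 / (4 * exp (1 / 4) * (8 * pi) powr (d / 2) * R powr (d + \<gamma>))
      \<le> R\<^sup>2 * ((2 * R\<^sup>2) powr (- \<gamma> / 2 - 1) * c)" .
  have "\<gamma> * (2 - \<gamma>) * I * (1 / (4 * exp (1 / 4) * (8 * pi) powr (d / 2) * R powr (d + \<gamma>)))
      \<le> \<gamma> * (2 - \<gamma>) * I * (R\<^sup>2 * ((2 * R\<^sup>2) powr (- \<gamma> / 2 - 1) * c))"
    using \<gamma> I0 by (intro mult_left_mono cc) auto
  also have "\<dots> \<le> 4 * E2"
    using m2 by (simp add: mult_ac)
  finally have "\<gamma> * (2 - \<gamma>) * I \<le> 4 * E2 * (4 * exp (1 / 4) * (8 * pi) powr (d / 2) * R powr (d + \<gamma>))"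
    using R by (simp add: pos_divide_le_eq)
  then show "\<gamma> * (2 - \<gamma>) * (LINT \<omega>|lborel. indicator (cball 0 R) \<omega> * (cmod (ft \<mu> \<omega> - ft \<nu> \<omega>))\<^sup>2)
        \<le> 16 * exp (1 / 4) * (8 * pi) powr (real DIM('a) / 2) * R powr (real DIM('a) + \<gamma>)
            * (energy_distance \<gamma> \<mu> \<nu>)\<^sup>2"
    using E2 by (simp add: ed I_def D_def d_def mult_ac)
qed

section \<open>Gaussian smoothing\<close>

lemma gauss_le:
  fixes x :: "'a::euclidean_space"
  shows "gauss s x \<le> (2 * pi * s\<^sup>2) powr (- real DIM('a) / 2)"
  unfolding gauss_def by (intro mult_left_le) auto

lemma four_mult_eq:
  fixes a b c d p q r :: real
  assumes "a * b = c * d" "p * p = q * r"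
  shows "p * a * (p * b) = q * c * (r * d)"
proof -
  have "p * a * (p * b) = (p * p) * (a * b)" by (simp only: mult_ac)
  also have "\<dots> = q * c * (r * d)" by (simp only: assms mult_ac)
  finally show ?thesis .
qed

text \<open>The parallelogram law about the midpoint completes the square. Only the last factor
  involves \<open>x\<close>, and it is a probability density in \<open>x\<close>.\<close>

lemma gauss_mult_gauss:
  fixes x y y' :: "'a::euclidean_space"
  assumes "0 < s"
  shows "gauss s (x - y) * gauss s (x - y')
    = (4 * pi * s\<^sup>2) powr (- real DIM('a) / 2) * exp (- (1 / (4 * s\<^sup>2)) * (norm (y - y'))\<^sup>2)
      * gauss (s / sqrt 2) (x - (1 / 2) *\<^sub>R (y + y'))"
proof -
  let ?p = "- real DIM('a) / 2"
  have "(norm (x - y))\<^sup>2 + (norm (x - y'))\<^sup>2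
      = 2 * (norm (x - (1 / 2) *\<^sub>R (y + y')))\<^sup>2 + (norm (y - y'))\<^sup>2 / 2"
    unfolding power2_norm_eq_inner by (simp add: inner_simps inner_commute field_simps)
  note this[symmetric]
  moreover have "- (norm (x - y))\<^sup>2 / (2 * s\<^sup>2) + - (norm (x - y'))\<^sup>2 / (2 * s\<^sup>2)
      = - ((norm (x - y))\<^sup>2 + (norm (x - y'))\<^sup>2) / (2 * s\<^sup>2)"
    by (simp add: diff_divide_distrib)
  moreover have "- (1 / (4 * s\<^sup>2)) * (norm (y - y'))\<^sup>2
        + - (norm (x - (1 / 2) *\<^sub>R (y + y')))\<^sup>2 / (2 * (s / sqrt 2)\<^sup>2)
      = - (2 * (norm (x - (1 / 2) *\<^sub>R (y + y')))\<^sup>2 + (norm (y - y'))\<^sup>2 / 2) / (2 * s\<^sup>2)"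
    using assms by (simp add: power_divide field_simps)
  ultimately have "- (norm (x - y))\<^sup>2 / (2 * s\<^sup>2) + - (norm (x - y'))\<^sup>2 / (2 * s\<^sup>2)
      = - (1 / (4 * s\<^sup>2)) * (norm (y - y'))\<^sup>2
        + - (norm (x - (1 / 2) *\<^sub>R (y + y')))\<^sup>2 / (2 * (s / sqrt 2)\<^sup>2)"
    by simp
  then have "exp (- (norm (x - y))\<^sup>2 / (2 * s\<^sup>2)) * exp (- (norm (x - y'))\<^sup>2 / (2 * s\<^sup>2))
      = exp (- (1 / (4 * s\<^sup>2)) * (norm (y - y'))\<^sup>2)
        * exp (- (norm (x - (1 / 2) *\<^sub>R (y + y')))\<^sup>2 / (2 * (s / sqrt 2)\<^sup>2))"
    by (simp only: exp_add[symmetric])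
  moreover have "(2 * pi * s\<^sup>2) powr ?p * (2 * pi * s\<^sup>2) powr ?p
      = (4 * pi * s\<^sup>2) powr ?p * (2 * pi * (s / sqrt 2)\<^sup>2) powr ?p"
    using assms by (simp add: powr_mult[symmetric] power_divide mult_ac)
  ultimately show ?thesis
    unfolding gauss_def by (rule four_mult_eq)
qed

lemma nn_integral_lborel_translate:
  fixes f :: "'a::euclidean_space \<Rightarrow> ennreal"
  assumes [measurable]: "f \<in> borel_measurable borel"
  shows "(\<integral>\<^sup>+x. f (x - m) \<partial>lborel) = (\<integral>\<^sup>+x. f x \<partial>lborel)"
  by (subst (2) lborel_distr_plus[of "- m", symmetric]) (simp add: nn_integral_distr)

text \<open>Density of \<open>P\<close> convolved with the normal law of width \<open>s\<close>, for
  an arbitrary law \<open>P\<close>.\<close>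

definition smoothed :: "real \<Rightarrow> 'a::euclidean_space measure \<Rightarrow> 'a \<Rightarrow> real" where
  "smoothed s P x = (LINT y|P. gauss s (x - y))"

lemma smoothed_measurable:
  assumes "prob_space P" and [measurable_cong]: "sets P = sets borel"
  shows "smoothed s P \<in> borel_measurable borel"
proof -
  interpret prob_space P by fact
  show ?thesis unfolding smoothed_def by measurable
qed

lemma integrable_gauss_diff:
  fixes P :: "'a::euclidean_space measure"
  assumes "prob_space P" and [measurable_cong]: "sets P = sets borel"
  shows "integrable P (\<lambda>y. gauss s (x - y))"
  using gauss_le by (intro integrable_bounded_prob[OF assms(1)]) auto

lemma smoothed_nonneg [simp]: "0 \<le> smoothed s P x"
  by (simp add: smoothed_def)

lemma ennreal_smoothed:
  fixes P :: "'a::euclidean_space measure"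
  assumes "prob_space P" "sets P = sets borel"
  shows "ennreal (smoothed s P x) = (\<integral>\<^sup>+y. gauss s (x - y) \<partial>P)"
  unfolding smoothed_def
  by (rule nn_integral_eq_integral[symmetric]) (auto intro!: integrable_gauss_diff assms)

text \<open>Integrating the product of Gaussians centred at \<open>y\<close> and \<open>y'\<close>
  over \<open>x\<close> leaves a kernel in \<open>y - y'\<close>; hence an L2 inner product becomes
  a \<open>gauss_mean\<close>, which is computable from the transforms.\<close>

lemma
  fixes P Q :: "'a::euclidean_space measure"
  assumes P: "prob_space P" and sP[measurable_cong]: "sets P = sets borel"
    and Q: "prob_space Q" and sQ[measurable_cong]: "sets Q = sets borel" and s: "0 < s"
  shows integrable_smoothed_mult: "integrable lborel (\<lambda>x. smoothed s P x * smoothed s Q x)"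
    and integral_smoothed_mult: "(LINT x|lborel. smoothed s P x * smoothed s Q x)
      = (4 * pi * s\<^sup>2) powr (- real DIM('a) / 2) * gauss_mean (1 / (4 * s\<^sup>2)) P Q"
proof -
  let ?C = "(4 * pi * s\<^sup>2) powr (- real DIM('a) / 2)"
  let ?t = "1 / (4 * s\<^sup>2)"
  interpret M1: prob_space P by fact
  interpret M2: prob_space Q by fact
  interpret LP: pair_sigma_finite P "lborel :: 'a measure" ..
  interpret LQ: pair_sigma_finite Q "lborel :: 'a measure" ..
  note [measurable] = smoothed_measurable[OF P sP] smoothed_measurable[OF Q sQ]
  have inner: "(\<integral>\<^sup>+x. ennreal (gauss s (x - y)) * ennreal (gauss s (x - y')) \<partial>lborel)
      = ennreal (?C * exp (- ?t * (norm (y - y'))\<^sup>2))" for y y' :: 'a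
  proof -
    have "(\<integral>\<^sup>+x. ennreal (gauss s (x - y)) * ennreal (gauss s (x - y')) \<partial>lborel)
      = (\<integral>\<^sup>+x. ennreal (?C * exp (- ?t * (norm (y - y'))\<^sup>2))
          * ennreal (gauss (s / sqrt 2) (x - (1 / 2) *\<^sub>R (y + y'))) \<partial>lborel)"
      by (intro nn_integral_cong) (simp only: ennreal_mult[symmetric] gauss_nonneg gauss_mult_gauss[OF s]
          mult_nonneg_nonneg powr_ge_zero exp_ge_zero)
    also have "\<dots> = ennreal (?C * exp (- ?t * (norm (y - y'))\<^sup>2))
        * (\<integral>\<^sup>+x. ennreal (gauss (s / sqrt 2) (x - (1 / 2) *\<^sub>R (y + y'))) \<partial>lborel)"
      by (rule nn_integral_cmult) measurable
    also have "(\<integral>\<^sup>+x. ennreal (gauss (s / sqrt 2) (x - (1 / 2) *\<^sub>R (y + y'))) \<partial>lborel) = 1"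
      using s by (subst nn_integral_lborel_translate) (auto simp: nn_integral_gauss)
    finally show ?thesis by simp
  qed
  have bnd: "integrable Q (\<lambda>y'. exp (- ?t * (norm (y - y'))\<^sup>2))" for y
    by (intro integrable_bounded_prob[OF Q, of _ 1]) auto
  have bnd2: "integrable P (\<lambda>y. LINT y'|Q. exp (- ?t * (norm (y - y'))\<^sup>2))"
  proof (intro integrable_bounded_prob[OF P, of _ 1])
    show "norm (LINT y'|Q. exp (- ?t * (norm (y - y'))\<^sup>2)) \<le> 1" for y
      using M2.integral_le_const[OF bnd[of y], where c = 1] by auto
  qed measurable
  have "(\<integral>\<^sup>+x. ennreal (smoothed s P x * smoothed s Q x) \<partial>lborel)
      = (\<integral>\<^sup>+x. (\<integral>\<^sup>+y. ennreal (gauss s (x - y)) * ennreal (smoothed s Q x) \<partial>P) \<partial>lborel)"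
    by (simp add: ennreal_mult' ennreal_smoothed[OF P sP] nn_integral_multc)
  also have "\<dots> = (\<integral>\<^sup>+y. (\<integral>\<^sup>+x. ennreal (gauss s (x - y)) * ennreal (smoothed s Q x) \<partial>lborel) \<partial>P)"
    by (rule LP.Fubini') measurable
  also have "\<dots> = (\<integral>\<^sup>+y. (\<integral>\<^sup>+x. (\<integral>\<^sup>+y'. ennreal (gauss s (x - y)) * ennreal (gauss s (x - y')) \<partial>Q) \<partial>lborel) \<partial>P)"
    by (simp add: ennreal_smoothed[OF Q sQ] nn_integral_cmult)
  also have "\<dots> = (\<integral>\<^sup>+y. (\<integral>\<^sup>+y'. (\<integral>\<^sup>+x. ennreal (gauss s (x - y)) * ennreal (gauss s (x - y')) \<partial>lborel) \<partial>Q) \<partial>P)"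
    by (intro nn_integral_cong LQ.Fubini') measurable
  also have "\<dots> = (\<integral>\<^sup>+y. (\<integral>\<^sup>+y'. ennreal (?C * exp (- ?t * (norm (y - y'))\<^sup>2)) \<partial>Q) \<partial>P)"
    by (simp only: inner)
  also have "\<dots> = (\<integral>\<^sup>+y. ennreal (?C * (LINT y'|Q. exp (- ?t * (norm (y - y'))\<^sup>2))) \<partial>P)"
    using bnd by (intro nn_integral_cong, subst nn_integral_eq_integral) (auto intro!: integrable_mult_right)
  also have "\<dots> = ennreal (?C * gauss_mean ?t P Q)"
    unfolding gauss_mean_def
    using bnd2 by (subst nn_integral_eq_integral) (auto intro!: integrable_mult_right)
  finally have *: "(\<integral>\<^sup>+x. ennreal (smoothed s P x * smoothed s Q x) \<partial>lborel) = ennreal (?C * gauss_mean ?t P Q)" .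
  show "integrable lborel (\<lambda>x. smoothed s P x * smoothed s Q x)"
    using * by (auto simp: integrable_iff_bounded abs_mult)
  have "0 \<le> ?C * gauss_mean ?t P Q"
    by (simp add: gauss_mean_def)
  then show "(LINT x|lborel. smoothed s P x * smoothed s Q x) = ?C * gauss_mean ?t P Q"
    using * by (subst integral_eq_nn_integral) auto
qed

text \<open>On the Fourier side the weight is \<open>gauss \<sigma>\<close>, and it is bounded by
  its maximum. The two normalising factors multiply to \<open>(2 * pi)\<close> to the power
  \<open>- d\<close>, with no trace of \<open>s\<close>.\<close>

lemma
  fixes P Q :: "'a::euclidean_space measure"
  assumes P: "prob_space P" and sP[measurable_cong]: "sets P = sets borel"
    and Q: "prob_space Q" and sQ[measurable_cong]: "sets Q = sets borel" and s: "0 < s"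
    and D: "integrable lborel (\<lambda>\<omega>. (cmod (ft P \<omega> - ft Q \<omega>))\<^sup>2)"
  shows integrable_smoothed_diff_sq:
      "integrable lborel (\<lambda>x. (smoothed s P x - smoothed s Q x)\<^sup>2)"
    and integral_smoothed_diff_sq_le:
      "(LINT x|lborel. (smoothed s P x - smoothed s Q x)\<^sup>2)
        \<le> (4 * pi\<^sup>2) powr (- real DIM('a) / 2) * (LINT \<omega>|lborel. (cmod (ft P \<omega> - ft Q \<omega>))\<^sup>2)"
proof -
  let ?p = "- real DIM('a) / 2"
  define \<sigma> where "\<sigma> = 1 / (sqrt 2 * s)"
  have \<sigma>: "0 < \<sigma>" "\<sigma>\<^sup>2 / 2 = 1 / (4 * s\<^sup>2)"
    using s by (auto simp: \<sigma>_def power_divide power_mult_distrib)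
  have eq: "(smoothed s P x - smoothed s Q x)\<^sup>2 = smoothed s P x * smoothed s P x
      + smoothed s Q x * smoothed s Q x - 2 * (smoothed s P x * smoothed s Q x)" for x
    by (simp add: power2_eq_square algebra_simps)
  note i = integrable_smoothed_mult[OF P sP P sP s] integrable_smoothed_mult[OF Q sQ Q sQ s]
    integrable_smoothed_mult[OF P sP Q sQ s]
  note e = integral_smoothed_mult[OF P sP P sP s] integral_smoothed_mult[OF Q sQ Q sQ s]
    integral_smoothed_mult[OF P sP Q sQ s]
  show "integrable lborel (\<lambda>x. (smoothed s P x - smoothed s Q x)\<^sup>2)"
    unfolding eq using i by simp
  have "(LINT x|lborel. (smoothed s P x - smoothed s Q x)\<^sup>2)
      = (LINT x|lborel. smoothed s P x * smoothed s P x) + (LINT x|lborel. smoothed s Q x * smoothed s Q x)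
        - 2 * (LINT x|lborel. smoothed s P x * smoothed s Q x)"
    unfolding eq using i by simp
  also have "\<dots> = (4 * pi * s\<^sup>2) powr ?p * (gauss_mean (\<sigma>\<^sup>2 / 2) P P + gauss_mean (\<sigma>\<^sup>2 / 2) Q Q - 2 * gauss_mean (\<sigma>\<^sup>2 / 2) P Q)"
    unfolding e \<sigma>(2) by (simp only: algebra_simps)
  also have "\<dots> = (4 * pi * s\<^sup>2) powr ?p * (LINT \<omega>|lborel. (cmod (ft P \<omega> - ft Q \<omega>))\<^sup>2 * gauss \<sigma> \<omega>)"
    by (simp only: integral_ft_diff_gauss[OF P sP Q sQ \<sigma>(1)])
  also have "\<dots> \<le> (4 * pi * s\<^sup>2) powr ?p
      * (LINT \<omega>|lborel. (cmod (ft P \<omega> - ft Q \<omega>))\<^sup>2 * (2 * pi * \<sigma>\<^sup>2) powr ?p)"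
  proof (intro mult_left_mono integral_mono)
    show "integrable lborel (\<lambda>\<omega>. (cmod (ft P \<omega> - ft Q \<omega>))\<^sup>2 * gauss \<sigma> \<omega>)"
      by (rule integrable_ft_diff_gauss[OF P sP Q sQ \<sigma>(1)])
    show "integrable lborel (\<lambda>\<omega>. (cmod (ft P \<omega> - ft Q \<omega>))\<^sup>2 * (2 * pi * \<sigma>\<^sup>2) powr ?p)"
      using D by (rule integrable_mult_left)
    show "gauss \<sigma> \<omega> \<le> (2 * pi * \<sigma>\<^sup>2) powr ?p" for \<omega> :: 'a
      by (rule gauss_le)
  qed auto
  also have "\<dots> = (4 * pi * s\<^sup>2) powr ?p * (2 * pi * \<sigma>\<^sup>2) powr ?p * (LINT \<omega>|lborel. (cmod (ft P \<omega> - ft Q \<omega>))\<^sup>2)"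
    by simp
  also have "(4 * pi * s\<^sup>2) powr ?p * (2 * pi * \<sigma>\<^sup>2) powr ?p = (4 * pi\<^sup>2) powr ?p"
  proof -
    have "(4 * pi * s\<^sup>2) * (2 * pi * \<sigma>\<^sup>2) = 4 * pi\<^sup>2"
      using s by (simp add: \<sigma>_def power_divide power_mult_distrib power2_eq_square)
    then show ?thesis by (simp only: powr_mult[symmetric])
  qed
  finally show "(LINT x|lborel. (smoothed s P x - smoothed s Q x)\<^sup>2)
        \<le> (4 * pi\<^sup>2) powr ?p * (LINT \<omega>|lborel. (cmod (ft P \<omega> - ft Q \<omega>))\<^sup>2)" .
qed

section \<open>Bounding measure differences by the Fourier transform\<close>

text \<open>The substitution \<open>x = y + s z\<close> moves the width out of the Gaussian and into
  the argument of \<open>h\<close>, so that for \<open>s\<close> tending to 0 the weight stays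
  fixed.\<close>

lemma integral_mult_gauss:
  fixes h :: "'a::euclidean_space \<Rightarrow> real"
  assumes [measurable]: "h \<in> borel_measurable borel" and s: "0 < s"
  shows "(LINT x|lborel. h x * gauss s (x - y)) = (LINT z|lborel. h (y + s *\<^sub>R z) * gauss 1 z)"
proof -
  have g: "\<bar>s\<bar> ^ DIM('a) * gauss s (s *\<^sub>R z) = gauss 1 z" for z :: 'a
  proof -
    have "(2 * pi * s\<^sup>2) powr (- real DIM('a) / 2) = (2 * pi) powr (- real DIM('a) / 2) * s powr (- real DIM('a))"
      using s powr_powr[of s 2 "- real DIM('a) / 2"] by (simp add: powr_mult)
    moreover have "s ^ DIM('a) * s powr (- real DIM('a)) = 1"
      using s by (simp add: powr_minus powr_realpow)
    ultimately show ?thesis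
      using s by (simp add: gauss_def power_mult_distrib mult.commute)
  qed
  have T: "(\<lambda>z. y + s *\<^sub>R z) \<in> measurable lborel borel" by measurable
  have eq: "\<bar>s\<bar> ^ DIM('a) *\<^sub>R (h (y + s *\<^sub>R z) * gauss s (s *\<^sub>R z)) = h (y + s *\<^sub>R z) * gauss 1 z" for z
    using g[of z] by (simp add: mult.left_commute)
  have m: "(\<lambda>x. h x * gauss s (x - y)) \<in> borel_measurable (distr lborel borel (\<lambda>z. y + s *\<^sub>R z))"
    "(\<lambda>x. \<bar>s\<bar> ^ DIM('a) *\<^sub>R (h x * gauss s (x - y))) \<in> borel_measurable borel"
    by measurable
  have L: "lborel = density (distr lborel borel (\<lambda>z. y + s *\<^sub>R z)) (\<lambda>_. ennreal (\<bar>s\<bar> ^ DIM('a)))"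
    using lborel_affine[of s y] s by simp
  have "(LINT x|lborel. h x * gauss s (x - y))
      = (LINT x|density (distr lborel borel (\<lambda>z. y + s *\<^sub>R z)) (\<lambda>_. ennreal (\<bar>s\<bar> ^ DIM('a))). h x * gauss s (x - y))"
    by (subst L) (rule refl)
  also have "\<dots> = (LINT x|distr lborel borel (\<lambda>z. y + s *\<^sub>R z). \<bar>s\<bar> ^ DIM('a) *\<^sub>R (h x * gauss s (x - y)))"
    by (rule integral_density[OF m(1)]) auto
  also have "\<dots> = (LINT z|lborel. \<bar>s\<bar> ^ DIM('a) *\<^sub>R (h (y + s *\<^sub>R z) * gauss s (y + s *\<^sub>R z - y)))"
    by (rule integral_distr[OF T m(2)])
  finally show ?thesis
    by (simp only: add_diff_cancel_left' eq)
qed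

text \<open>Fubini needs joint integrability under \<open>P\<close> and Lebesgue measure; it holds
  because \<open>h\<close> lives on a ball and the Gaussian is bounded.\<close>

lemma integral_mult_smoothed:
  fixes h :: "'a::euclidean_space \<Rightarrow> real"
  assumes P: "prob_space P" and sP[measurable_cong]: "sets P = sets borel"
    and [measurable]: "h \<in> borel_measurable borel"
    and h: "\<And>x. 0 \<le> h x" "\<And>x. h x \<le> indicator (cball 0 \<rho>) x" and s: "0 < s"
  shows "(LINT x|lborel. h x * smoothed s P x) = (LINT y|P. LINT z|lborel. h (y + s *\<^sub>R z) * gauss 1 z)"
proof -
  interpret M: prob_space P by fact
  interpret pair_sigma_finite P "lborel :: 'a measure" ..
  have ih: "integrable lborel h"
  proof (rule Bochner_Integration.integrable_bound)
    show "integrable lborel (indicator (cball 0 \<rho>) :: 'a \<Rightarrow> real)"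
      using emeasure_bounded_finite[OF bounded_cball, of "0::'a" \<rho>] by (intro integrable_real_indicator) auto
  qed (use h in auto)
  have "integrable (P \<Otimes>\<^sub>M lborel) (\<lambda>(y, x). h x * gauss s (x - y))"
  proof (rule Bochner_Integration.integrable_bound)
    have "integrable (P \<Otimes>\<^sub>M lborel) (\<lambda>(y, x). h x)"
    proof (rule Fubini_integrable)
      show "integrable P (\<lambda>y. LINT x|lborel. norm (case (y, x) of (y, x) \<Rightarrow> h x))"
        by simp
      show "AE y in P. integrable lborel (\<lambda>x. case (y, x) of (y, x) \<Rightarrow> h x)"
        using ih by simp
    qed measurable
    then show "integrable (P \<Otimes>\<^sub>M lborel) (\<lambda>z. (2 * pi * s\<^sup>2) powr (- real DIM('a) / 2) * (case z of (y, x) \<Rightarrow> h x))"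
      by (rule integrable_mult_right)
    show "AE z in P \<Otimes>\<^sub>M lborel. norm (case z of (y, x) \<Rightarrow> h x * gauss s (x - y))
       \<le> norm ((2 * pi * s\<^sup>2) powr (- real DIM('a) / 2) * (case z of (y, x) \<Rightarrow> h x))"
    proof (rule AE_I2)
      fix z :: "'a \<times> 'a"
      obtain y x where z: "z = (y, x)" by (cases z)
      show "norm (case z of (y, x) \<Rightarrow> h x * gauss s (x - y))
         \<le> norm ((2 * pi * s\<^sup>2) powr (- real DIM('a) / 2) * (case z of (y, x) \<Rightarrow> h x))"
        using mult_left_mono[OF gauss_le[of s "x - y"] h(1)[of x]] h(1)[of x]
        by (simp add: z mult.commute)
    qed
  qed measurable
  from Fubini_integral[OF this]
  have "(LINT x|lborel. LINT y|P. h x * gauss s (x - y)) = (LINT y|P. LINT x|lborel. h x * gauss s (x - y))" .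
  moreover have "(LINT x|lborel. h x * smoothed s P x) = (LINT x|lborel. LINT y|P. h x * gauss s (x - y))"
    unfolding smoothed_def by simp
  ultimately show ?thesis
    using integral_mult_gauss[OF \<open>h \<in> borel_measurable borel\<close> s] by simp
qed

text \<open>Smoothed laws converge weakly: dominated convergence is applied once in the noise
  variable \<open>z\<close>, using continuity of \<open>h\<close>, and once under
  \<open>P\<close>.\<close>

lemma tendsto_integral_mult_smoothed:
  fixes h :: "'a::euclidean_space \<Rightarrow> real"
  assumes P: "prob_space P" and sP[measurable_cong]: "sets P = sets borel"
    and ch: "continuous_on UNIV h"
    and h: "\<And>x. 0 \<le> h x" "\<And>x. h x \<le> indicator (cball 0 \<rho>) x"
  shows "(\<lambda>n. LINT x|lborel. h x * smoothed (1 / real (Suc n)) P x) \<longlonglongrightarrow> (LINT x|P. h x)"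
proof -
  interpret M: prob_space P by fact
  have [measurable]: "h \<in> borel_measurable borel"
    using ch by (rule borel_measurable_continuous_onI)
  have h1: "\<bar>h x\<bar> \<le> 1" for x
    using h(1)[of x] order_trans[OF h(2)[of x] indicator_le_1] by simp
  have iz: "integrable lborel (\<lambda>z. h (y + s *\<^sub>R z) * gauss 1 z)" for y s
    by (rule Bochner_Integration.integrable_bound[OF integrable_gauss[of 1]])
       (use h1 in \<open>auto simp: abs_mult intro!: mult_left_le_one_le\<close>)
  let ?H = "\<lambda>s y. LINT z|lborel. h (y + s *\<^sub>R z) * gauss 1 z"
  have H1: "\<bar>?H s y\<bar> \<le> 1" for s y
  proof -
    have "\<bar>?H s y\<bar> \<le> (LINT z|lborel. \<bar>h (y + s *\<^sub>R z) * gauss 1 z\<bar>)"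
      using integral_norm_bound[of lborel "\<lambda>z. h (y + s *\<^sub>R z) * gauss 1 z"] by simp
    also have "\<dots> \<le> (LINT z|lborel. gauss 1 (z::'a))"
      using iz[of y s] h1 by (intro integral_mono integrable_abs)
         (auto simp: abs_mult integrable_gauss intro!: mult_left_le_one_le)
    also have "\<dots> = 1" by (simp add: integral_gauss)
    finally show ?thesis .
  qed
  have lim: "(\<lambda>n. ?H (1 / real (Suc n)) y) \<longlonglongrightarrow> h y" for y
  proof -
    have "(\<lambda>n. ?H (1 / real (Suc n)) y) \<longlonglongrightarrow> (LINT z|lborel. h y * gauss 1 (z::'a))"
    proof (rule integral_dominated_convergence[where w = "gauss 1"])
      show "AE z in lborel. (\<lambda>n. h (y + (1 / real (Suc n)) *\<^sub>R z) * gauss 1 z) \<longlonglongrightarrow> h y * gauss 1 z"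
      proof (rule AE_I2)
        fix z :: 'a
        have "(\<lambda>n. y + (1 / real (Suc n)) *\<^sub>R z) \<longlonglongrightarrow> y + 0 *\<^sub>R z"
          using LIMSEQ_inverse_real_of_nat by (intro tendsto_intros) (simp add: inverse_eq_divide)
        moreover have "isCont h y"
          using ch by (simp add: continuous_on_eq_continuous_at)
        ultimately have "(\<lambda>n. h (y + (1 / real (Suc n)) *\<^sub>R z)) \<longlonglongrightarrow> h y"
          using isCont_tendsto_compose[of y h "\<lambda>n. y + (1 / real (Suc n)) *\<^sub>R z" sequentially] by simp
        then show "(\<lambda>n. h (y + (1 / real (Suc n)) *\<^sub>R z) * gauss 1 z) \<longlonglongrightarrow> h y * gauss 1 z"
          by (intro tendsto_intros)
      qed
      show "AE z in lborel. norm (h (y + (1 / real (Suc n)) *\<^sub>R z) * gauss 1 z) \<le> gauss 1 z" for n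
        using h1 by (auto simp: abs_mult intro!: mult_left_le_one_le)
    qed (auto simp: integrable_gauss)
    then show ?thesis by (simp add: integral_gauss)
  qed
  have "(\<lambda>n. LINT y|P. ?H (1 / real (Suc n)) y) \<longlonglongrightarrow> (LINT y|P. h y)"
  proof (rule integral_dominated_convergence[where w = "\<lambda>_. 1"])
    show "AE y in P. (\<lambda>n. ?H (1 / real (Suc n)) y) \<longlonglongrightarrow> h y"
      using lim by simp
    show "AE y in P. norm (?H (1 / real (Suc n)) y) \<le> 1" for n
      using H1 by simp
  qed auto
  then show ?thesis
    by (subst integral_mult_smoothed[OF P sP _ h]) auto
qed

text \<open>Young's inequality \<open>h f \<le> a h^2 + f^2 / a\<close> with \<open>f\<close> the
  difference of smoothed densities; \<open>h^2\<close> is at most the indicator of the ball, which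
  produces the volume. The parameter \<open>a\<close> stays free until \<open>arith_geo_min\<close>.
  Continuity of \<open>h\<close> lets the smoothing width tend to 0.\<close>

lemma continuous_test_diff_le:
  fixes P Q :: "'a::euclidean_space measure"
  assumes P: "prob_space P" and sP[measurable_cong]: "sets P = sets borel"
    and Q: "prob_space Q" and sQ[measurable_cong]: "sets Q = sets borel"
    and D: "integrable lborel (\<lambda>\<omega>. (cmod (ft P \<omega> - ft Q \<omega>))\<^sup>2)"
    and ch: "continuous_on UNIV h"
    and h: "\<And>x. 0 \<le> h x" "\<And>x. h x \<le> indicator (cball 0 \<rho>) x" and a: "0 < a"
  shows "(LINT x|P. h x) - (LINT x|Q. h x) \<le> a * measure lborel (cball (0::'a) \<rho>)
    + (4 * pi\<^sup>2) powr (- real DIM('a) / 2) * (LINT \<omega>|lborel. (cmod (ft P \<omega> - ft Q \<omega>))\<^sup>2) / a"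
proof (rule LIMSEQ_le_const2)
  show "(\<lambda>n. (LINT x|lborel. h x * smoothed (1 / real (Suc n)) P x)
      - (LINT x|lborel. h x * smoothed (1 / real (Suc n)) Q x)) \<longlonglongrightarrow> (LINT x|P. h x) - (LINT x|Q. h x)"
    by (intro tendsto_diff tendsto_integral_mult_smoothed[OF P sP ch h] tendsto_integral_mult_smoothed[OF Q sQ ch h])
  have [measurable]: "h \<in> borel_measurable borel"
    using ch by (rule borel_measurable_continuous_onI)
  have "(LINT x|lborel. h x * smoothed s P x) - (LINT x|lborel. h x * smoothed s Q x)
     \<le> a * measure lborel (cball (0::'a) \<rho>)
    + (4 * pi\<^sup>2) powr (- real DIM('a) / 2) * (LINT \<omega>|lborel. (cmod (ft P \<omega> - ft Q \<omega>))\<^sup>2) / a" (is "?l \<le> ?r")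
    if s: "0 < s" for s :: real
  proof -
    note [measurable] = smoothed_measurable[OF P sP] smoothed_measurable[OF Q sQ]
    have i: "integrable lborel (\<lambda>x. h x * smoothed s M x)"
      if M: "prob_space M" "sets M = sets borel" for M
    proof -
      have [measurable]: "smoothed s M \<in> borel_measurable borel"
        by (rule smoothed_measurable[OF M])
      have sm: "smoothed s M x \<le> (2 * pi * s\<^sup>2) powr (- real DIM('a) / 2)" for x
        unfolding smoothed_def using integrable_gauss_diff[OF M] gauss_le[where 'a = 'a]
        by (intro prob_space.integral_le_const[OF M(1)]) auto
      have "integrable lborel (\<lambda>x::'a. (2 * pi * s\<^sup>2) powr (- real DIM('a) / 2) * indicator (cball 0 \<rho>) x :: real)"
        using emeasure_bounded_finite[OF bounded_cball, of "0::'a" \<rho>]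
        by (intro integrable_mult_right integrable_real_indicator) auto
      then show ?thesis
        by (rule Bochner_Integration.integrable_bound)
           (use h sm in \<open>auto simp: abs_mult mult.commute[of "h _"] intro!: mult_mono\<close>)
    qed
    have "?l = (LINT x|lborel. h x * smoothed s P x - h x * smoothed s Q x)"
      using i[OF P sP] i[OF Q sQ] by simp
    also have "\<dots> \<le> (LINT x|lborel. a * indicator (cball 0 \<rho>) x + (smoothed s P x - smoothed s Q x)\<^sup>2 / a)"
    proof (rule integral_mono)
      show "integrable lborel (\<lambda>x. h x * smoothed s P x - h x * smoothed s Q x)"
        using i[OF P sP] i[OF Q sQ] by simp
      show "integrable lborel (\<lambda>x. a * indicator (cball 0 \<rho>) x + (smoothed s P x - smoothed s Q x)\<^sup>2 / a)"
        using emeasure_bounded_finite[OF bounded_cball, of "0::'a" \<rho>]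
          integrable_smoothed_diff_sq[OF P sP Q sQ s D]
        by (intro Bochner_Integration.integrable_add integrable_mult_right integrable_real_indicator integrable_divide) auto
      fix x :: 'a
      define f where "f = smoothed s P x - smoothed s Q x"
      define i where "i = (indicator (cball 0 \<rho>) x :: real)"
      \<comment> \<open>Expanding this square is Young's inequality; its factor \<open>1 / 2\<close>
        is given away.\<close>
      have "0 \<le> (a * h x - f)\<^sup>2" by simp
      then have "2 * (a * (h x * f)) \<le> a * a * (h x * h x) + f\<^sup>2"
        by (simp add: power2_eq_square algebra_simps)
      moreover have "a * a * (h x * h x) \<le> a * a * i"
      proof -
        have "h x * h x \<le> i * 1"
          using h(1)[of x] h(2)[of x] order_trans[OF h(2)[of x] indicator_le_1]
          by (intro mult_mono) (simp_all add: i_def)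
        then show ?thesis using a by (intro mult_left_mono) auto
      qed
      moreover have "0 \<le> a * a * i" "0 \<le> f\<^sup>2" by (auto simp: i_def)
      ultimately have "a * (h x * f) \<le> a * a * i + f\<^sup>2" by linarith
      also have "\<dots> = a * (a * i + f\<^sup>2 / a)" using a by (simp add: field_simps)
      finally have "h x * f \<le> a * i + f\<^sup>2 / a" using a by simp
      then show "h x * smoothed s P x - h x * smoothed s Q x
        \<le> a * indicator (cball 0 \<rho>) x + (smoothed s P x - smoothed s Q x)\<^sup>2 / a"
        by (simp add: f_def i_def algebra_simps)
    qed
    also have "\<dots> = a * measure lborel (cball (0::'a) \<rho>) + (LINT x|lborel. (smoothed s P x - smoothed s Q x)\<^sup>2) / a"
      using emeasure_bounded_finite[OF bounded_cball, of "0::'a" \<rho>]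
        integrable_smoothed_diff_sq[OF P sP Q sQ s D]
      by (subst Bochner_Integration.integral_add) (auto intro!: integrable_mult_right integrable_real_indicator)
    also have "\<dots> \<le> ?r"
      using a integral_smoothed_diff_sq_le[OF P sP Q sQ s D] by (intro add_left_mono divide_right_mono) auto
    finally show ?thesis .
  qed
  then show "\<exists>N. \<forall>n\<ge>N. (LINT x|lborel. h x * smoothed (1 / real (Suc n)) P x)
      - (LINT x|lborel. h x * smoothed (1 / real (Suc n)) Q x) \<le> a * measure lborel (cball (0::'a) \<rho>)
    + (4 * pi\<^sup>2) powr (- real DIM('a) / 2) * (LINT \<omega>|lborel. (cmod (ft P \<omega> - ft Q \<omega>))\<^sup>2) / a"
    by (intro exI[of _ 0]) auto
qed

text \<open>Inner regularity reduces \<open>A\<close> to compact sets, whose indicators are limits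
  of continuous bumps. The bumps reach at most distance 1 beyond the set, hence the radius
  \<open>r + 1\<close>.\<close>

lemma measure_diff_le:
  fixes P Q :: "'a::euclidean_space measure"
  assumes P: "prob_space P" and sP[measurable_cong]: "sets P = sets borel"
    and Q: "prob_space Q" and sQ[measurable_cong]: "sets Q = sets borel"
    and D: "integrable lborel (\<lambda>\<omega>. (cmod (ft P \<omega> - ft Q \<omega>))\<^sup>2)"
    and A: "A \<in> sets borel" "A \<subseteq> cball 0 r" and a: "0 < a"
  shows "measure P A - measure Q A \<le> a * measure lborel (cball (0::'a) (r + 1))
    + (4 * pi\<^sup>2) powr (- real DIM('a) / 2) * (LINT \<omega>|lborel. (cmod (ft P \<omega> - ft Q \<omega>))\<^sup>2) / a" (is "_ \<le> ?r")
proof -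
  interpret M1: prob_space P by fact
  interpret M2: prob_space Q by fact
  have compact: "measure P K - measure Q K \<le> ?r" if K: "compact K" "K \<subseteq> cball 0 r" for K
  proof (cases "K = {}")
    case True
    have "0 \<le> (LINT \<omega>|lborel. (cmod (ft P \<omega> - ft Q \<omega>))\<^sup>2)" by simp
    with True a show ?thesis by auto
  next
    case False
    \<comment> \<open>Equal to 1 on \<open>K\<close> and 0 from distance \<open>1 / Suc m\<close>
      on. With \<open>Suc m\<close> that distance is at most 1 already for
      \<open>m = 0\<close>.\<close>
    define h where "h m x = max 0 (1 - real (Suc m) * infdist x K)" for m and x :: 'a
    have ch: "continuous_on UNIV (h m)" for m
      unfolding h_def by (intro continuous_intros)
    then have [measurable]: "h m \<in> borel_measurable borel" for m
      by (rule borel_measurable_continuous_onI)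
    have h0: "0 \<le> h m x" and h1: "h m x \<le> 1" for m x
      by (auto simp: h_def infdist_nonneg)
    have hi: "h m x \<le> indicator (cball 0 (r + 1)) x" for m x
    proof (cases "norm x \<le> r + 1")
      case False
      obtain y where y: "y \<in> K" "infdist x K = dist x y"
        using infdist_attains_inf[of K x] K(1) \<open>K \<noteq> {}\<close> compact_imp_closed by metis
      have "norm x \<le> dist x y + norm y"
        by (metis dist_0_norm dist_commute dist_triangle)
      moreover have "norm y \<le> r" using y K by auto
      ultimately have "1 \<le> infdist x K" using False y by linarith
      then have "1 * 1 \<le> real (Suc m) * infdist x K" by (intro mult_mono) auto
      then show ?thesis by (simp add: h_def)
    qed (use h1 in auto)
    have lim: "(\<lambda>m. h m x) \<longlonglongrightarrow> indicator K x" for x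
    proof (cases "x \<in> K")
      case True
      then show ?thesis by (simp add: h_def)
    next
      case x: False
      then have pos: "0 < infdist x K"
        using infdist_pos_not_in_closed[of K x] K(1) \<open>K \<noteq> {}\<close> compact_imp_closed by blast
      obtain N where N: "1 / infdist x K < real N" using reals_Archimedean2 by blast
      have "h m x = 0" if "N \<le> m" for m
      proof -
        have "1 / infdist x K \<le> real (Suc m)" using N that by linarith
        then have "1 \<le> real (Suc m) * infdist x K" using pos by (simp add: divide_le_eq)
        then show ?thesis by (simp add: h_def)
      qed
      then have "eventually (\<lambda>m. h m x = 0) sequentially" by (auto simp: eventually_sequentially)
      then show ?thesis using x by (simp add: tendsto_eventually)
    qed
    have conv: "(\<lambda>m. LINT x|M. h m x) \<longlonglongrightarrow> measure M K"
      if M: "prob_space M" and sM[measurable_cong]: "sets M = sets borel" for M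
    proof -
      interpret prob_space M by fact
      have [measurable]: "K \<in> sets M" using K(1) by (auto simp: sM compact_imp_closed)
      have "(\<lambda>m. LINT x|M. h m x) \<longlonglongrightarrow> (LINT x|M. indicator K x)"
      proof (rule integral_dominated_convergence[where w = "\<lambda>_. 1"])
        show "AE x in M. norm (h m x) \<le> 1" for m
          using h0 h1 by simp
      qed (use lim in auto)
      then show ?thesis by simp
    qed
    show ?thesis
    proof (rule LIMSEQ_le_const2)
      show "(\<lambda>m. (LINT x|P. h m x) - (LINT x|Q. h m x)) \<longlonglongrightarrow> measure P K - measure Q K"
        by (intro tendsto_diff conv P sP Q sQ)
      show "\<exists>N. \<forall>m\<ge>N. (LINT x|P. h m x) - (LINT x|Q. h m x) \<le> ?r"
        using continuous_test_diff_le[OF P sP Q sQ D ch h0 hi a] by blast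
    qed
  qed
  \<comment> \<open>Regularity is applied under \<open>P\<close>; under \<open>Q\<close>,
    monotonicity \<open>Q K \<le> Q A\<close> already points the right way.\<close>
  have "emeasure P A = (SUP K\<in>{K. K \<subseteq> A \<and> compact K}. emeasure P K)"
    using A M1.emeasure_space_1 by (intro inner_regular sP) auto
  also have "\<dots> \<le> ennreal (measure Q A + ?r)"
  proof (rule SUP_least)
    fix K assume K: "K \<in> {K. K \<subseteq> A \<and> compact K}"
    then have "compact K" "K \<subseteq> cball 0 r" using A by auto
    from compact[OF this] have "measure P K \<le> measure Q K + ?r" by linarith
    also have "measure Q K \<le> measure Q A"
      using K A sQ by (intro M2.finite_measure_mono) auto
    finally have "measure P K \<le> measure Q A + ?r" by simp
    then show "emeasure P K \<le> ennreal (measure Q A + ?r)"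
      by (simp add: M1.emeasure_eq_measure ennreal_leI)
  qed
  finally have "ennreal (measure P A) \<le> ennreal (measure Q A + ?r)"
    by (simp only: M1.emeasure_eq_measure)
  moreover have "0 \<le> measure Q A + ?r"
    using a by (intro add_nonneg_nonneg mult_nonneg_nonneg divide_nonneg_nonneg
        Bochner_Integration.integral_nonneg) auto
  ultimately have "measure P A \<le> measure Q A + ?r"
    by (simp only: ennreal_le_iff)
  then show ?thesis by linarith
qed

text \<open>The minimiser is \<open>a = sqrt (W / V)\<close>. For \<open>W = 0\<close> the infimum
  is not attained and \<open>a\<close> is sent to 0 instead.\<close>

lemma arith_geo_min:
  fixes x V W :: real
  assumes "0 < V" "0 \<le> W" "\<And>a. 0 < a \<Longrightarrow> x \<le> a * V + W / a"
  shows "x \<le> 2 * sqrt (V * W)"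
proof (cases "W = 0")
  case True
  have "x \<le> 0"
  proof (rule field_le_epsilon)
    fix e :: real assume "0 < e"
    then show "x \<le> 0 + e" using assms(3)[of "e / V"] assms(1) True by simp
  qed
  then show ?thesis using True by simp
next
  case False
  then have W: "0 < W" using assms by simp
  have "x \<le> sqrt (W / V) * V + W / sqrt (W / V)"
    using W assms by (intro assms(3)) auto
  also have "sqrt (W / V) * V = sqrt (V * W)"
    using W assms(1) by (simp add: real_sqrt_divide real_sqrt_mult real_div_sqrt field_simps)
  also have "W / sqrt (W / V) = sqrt (V * W)"
    using W assms(1) by (simp add: real_sqrt_divide real_sqrt_mult real_div_sqrt field_simps)
  finally show ?thesis by simp
qed

lemma measure_diff_le_sqrt:
  fixes P Q :: "'a::euclidean_space measure"
  assumes "prob_space P" "sets P = sets borel" "prob_space Q" "sets Q = sets borel"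
    and "integrable lborel (\<lambda>\<omega>. (cmod (ft P \<omega> - ft Q \<omega>))\<^sup>2)"
    and "A \<in> sets borel" "A \<subseteq> cball 0 r" and r: "0 \<le> r"
  shows "measure P A - measure Q A \<le> 2 * sqrt (measure lborel (cball (0::'a) (r + 1)) *
    ((4 * pi\<^sup>2) powr (- real DIM('a) / 2) * (LINT \<omega>|lborel. (cmod (ft P \<omega> - ft Q \<omega>))\<^sup>2)))"
  by (rule arith_geo_min) (use r measure_diff_le[OF assms(1-7)] in auto)

section \<open>Optimising the truncation radius\<close>

lemma TV_nonneg:
  assumes "prob_space \<mu>" "prob_space \<nu>"
  shows "0 \<le> TV \<mu> \<nu>"
proof -
  interpret M1: prob_space \<mu> by fact
  interpret M2: prob_space \<nu> by fact
  have "measure \<mu> A - measure \<nu> A \<le> 1" for A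
    using M1.prob_le_1[of A] measure_nonneg[of \<nu> A] by linarith
  then have "bdd_above ((\<lambda>A. measure \<mu> A - measure \<nu> A) ` sets \<mu>)"
    by (intro bdd_aboveI2) auto
  from cSUP_upper[OF sets.empty_sets this] show ?thesis
    by (simp add: TV_def)
qed

lemma TV_le:
  assumes "\<And>A. A \<in> sets \<mu> \<Longrightarrow> measure \<mu> A - measure \<nu> A \<le> b"
  shows "TV \<mu> \<nu> \<le> b"
  unfolding TV_def using assms by (intro cSUP_least) auto

text \<open>\<open>T\<close> stands for the total variation, \<open>S\<close> for the Sobolev term,
  \<open>E\<close> for the energy distance. \<open>R\<close> is chosen so that the tail
  \<open>R powr (- m) * S\<close> is exactly half of \<open>T^2 / B\<close>; the energy term must
  then supply the other half.\<close>

lemma powr_interpolation: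
  fixes T B q E S m n :: real
  assumes T: "0 \<le> T" and B: "0 < B" and q: "0 < q" and E: "0 \<le> E" and S: "0 \<le> S"
    and m: "0 < m" and n: "0 < n"
    and le: "\<And>R. 0 < R \<Longrightarrow> T\<^sup>2 \<le> B * (R powr n * (E\<^sup>2 / q) + R powr (- m) * S)"
  shows "sqrt q * T powr ((m + n) / m) \<le> (2 * B) powr ((m + n) / (2 * m)) * S powr (n / (2 * m)) * E"
proof (cases "T = 0")
  case True
  then show ?thesis using E by simp
next
  case False
  define a where "a = E\<^sup>2 / q"
  define x where "x = T\<^sup>2 / B"
  define p where "p = (m + n) / m"
  have p: "p = 1 + n / m" using m by (simp add: p_def add_divide_distrib)
  have x: "0 < x" using False B by (simp add: x_def)
  have a: "0 \<le> a" using q by (simp add: a_def)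
  have xle: "x \<le> R powr n * a + R powr (- m) * S" if "0 < R" for R
    using le[OF that] B by (simp add: x_def a_def pos_divide_le_eq mult.commute)
  \<comment> \<open>The balancing radius would degenerate to 0 for \<open>S = 0\<close>. This case
    is impossible: the radius with \<open>R powr n * a = x / 2\<close> contradicts
    \<open>x > 0\<close>.\<close>
  have "S \<noteq> 0"
  proof
    assume "S = 0"
    then have *: "x \<le> R powr n * a" if "0 < R" for R using xle[OF that] by simp
    then have "a \<noteq> 0" using x *[of 1] by auto
    with a have "0 < a" by simp
    then have "x \<le> x / 2"
      using *[of "(x / (2 * a)) powr (1 / n)"] x n by (simp add: powr_powr)
    with x show False by simp
  qed
  with S have S: "0 < S" by simp
  have "x \<le> ((2 * S / x) powr (1 / m)) powr n * a + ((2 * S / x) powr (1 / m)) powr (- m) * S"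
    using S x by (intro xle) simp
  also have "((2 * S / x) powr (1 / m)) powr n = (2 * S / x) powr (n / m)"
    by (simp add: powr_powr)
  also have "((2 * S / x) powr (1 / m)) powr (- m) = x / (2 * S)"
    using m S x by (simp add: powr_powr powr_minus)
  finally have "x / 2 \<le> (2 * S / x) powr (n / m) * a"
    using S by simp
  then have "x / 2 * (2 * x powr (n / m)) \<le> (2 * S / x) powr (n / m) * a * (2 * x powr (n / m))"
    by (rule mult_right_mono) simp
  also have "\<dots> = 2 * (2 powr (n / m) * S powr (n / m)) * a"
    using S x by (simp add: powr_divide powr_mult)
  also have "x / 2 * (2 * x powr (n / m)) = x powr p"
    using x by (simp add: p powr_add)
  also have "2 * (2 powr (n / m) * S powr (n / m)) * a = 2 powr p * S powr (n / m) * a"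
    by (simp add: p powr_add)
  finally have xp: "x powr p \<le> 2 powr p * S powr (n / m) * a" .
  have sq: "(u powr (v / 2))\<^sup>2 = u powr v" for u v :: real
    by (simp add: power2_eq_square powr_add[symmetric])
  have "(sqrt q * T powr p)\<^sup>2 = q * (T\<^sup>2) powr p"
    using q False T by (simp add: power_mult_distrib power2_eq_square powr_mult)
  also have "\<dots> = q * (B powr p * x powr p)"
    using B x by (simp add: x_def powr_mult[symmetric])
  also have "\<dots> \<le> q * (B powr p * (2 powr p * S powr (n / m) * a))"
    using q xp by (intro mult_left_mono) auto
  also have "\<dots> = (2 * B) powr p * S powr (n / m) * E\<^sup>2"
    using q B by (simp add: a_def powr_mult)
  also have "\<dots> = ((2 * B) powr (p / 2) * S powr (n / m / 2) * E)\<^sup>2"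
    by (simp only: power_mult_distrib sq)
  finally have "sqrt q * T powr p \<le> (2 * B) powr (p / 2) * S powr (n / m / 2) * E"
    by (rule power2_le_imp_le) (use E in auto)
  then show ?thesis by (simp add: p_def mult.commute)
qed

text \<open>Polynomial growth from the volume is traded for half of a decay
  \<open>exp (- r\<^sup>2 / 4)\<close>, leaving the same rate \<open>exp (- r\<^sup>2 / 8)\<close>
  as the spatial tail of a mixture.\<close>

lemma powr_le_exp_sq:
  fixes r d :: real
  assumes "1 \<le> r" "0 \<le> d"
  shows "r powr (d / 2) \<le> exp (d\<^sup>2 / 2) * exp (r\<^sup>2 / 8)"
proof -
  have "ln r \<le> r" using ln_le_minus_one[of r] assms by linarith
  then have "d / 2 * ln r \<le> d / 2 * r" using assms by (intro mult_left_mono) auto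
  also have "d / 2 * r \<le> d\<^sup>2 / 2 + r\<^sup>2 / 8"
    using zero_le_power2[of "r / 2 - d"] by (simp add: power2_eq_square algebra_simps)
  finally show ?thesis
    using assms by (simp add: powr_def exp_add[symmetric])
qed

text \<open>\<open>r\<close> is chosen so that the remainder is at most \<open>T / 2\<close> and can
  be absorbed on the left. With \<open>L = ln (3 + 1 / T)\<close>, \<open>r\<^sup>2 = 8 * L\<close>
  would give \<open>C * T\<close>; the factor \<open>\<kappa> = 1 + ln (2 * C)\<close> gains the
  missing \<open>1 / (2 * C)\<close>, because \<open>L \<ge> 1\<close>.\<close>

lemma log_interpolation:
  fixes T C c q E d \<gamma> :: real
  assumes T: "0 \<le> T" and C: "1 \<le> C" and c: "0 \<le> c" and q: "0 < q" and E: "0 \<le> E"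
    and d: "0 \<le> d" and \<gamma>: "0 \<le> \<gamma>" "\<gamma> \<le> 2"
    and le: "\<And>r. 1 \<le> r \<Longrightarrow> T \<le> C * exp (- r\<^sup>2 / 8) + c * r powr (d + \<gamma> / 2) * (E / sqrt q)"
  shows "sqrt q * T / ln (3 + 1 / T) powr ((2 * d + \<gamma>) / 4)
    \<le> 2 * c * (8 * (1 + ln (2 * C))) powr ((d + 1) / 2) * E"
proof (cases "T = 0")
  \<comment> \<open>Here \<open>1 / T\<close> defaults to 0 and the numerator vanishes, in
    accordance with the convention that the left side is 0.\<close>
  case True
  then show ?thesis using c E by simp
next
  case False
  with T have T: "0 < T" by simp
  define L where "L = ln (3 + 1 / T)"
  define \<kappa> where "\<kappa> = 1 + ln (2 * C)"
  define r where "r = sqrt (8 * \<kappa> * L)"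
  have \<kappa>: "1 \<le> \<kappa>" using C by (simp add: \<kappa>_def)
  \<comment> \<open>This is what the 3 inside the logarithm provides: \<open>L \<ge> 1\<close>,
    however large \<open>T\<close> is.\<close>
  have "exp 1 \<le> 3 + 1 / T"
    using exp_le T by (intro order_trans[OF exp_le]) simp
  then have L: "1 \<le> L"
    using T unfolding L_def by (subst ln_ge_iff) (auto intro: add_pos_pos)
  have kL: "1 \<le> \<kappa> * L" using mult_mono[OF \<kappa> L] \<kappa> by simp
  have r: "1 \<le> r" using kL by (simp add: r_def)
  have r2: "r\<^sup>2 = 8 * \<kappa> * L" using mult_nonneg_nonneg[of L \<kappa>] \<kappa> L by (simp add: r_def)
  have eL: "exp (- L) \<le> T"
    using T by (simp add: L_def exp_minus add_pos_pos divide_simps)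
  have "C * exp (- r\<^sup>2 / 8) = C * (exp (- L) * exp (- ((\<kappa> - 1) * L)))"
    by (simp add: r2 exp_add[symmetric] algebra_simps)
  also have "\<dots> \<le> C * (T * exp (- ((\<kappa> - 1) * 1)))"
  proof -
    have "(\<kappa> - 1) * 1 \<le> (\<kappa> - 1) * L"
      using \<kappa> L by (intro mult_left_mono) auto
    then have "exp (- ((\<kappa> - 1) * L)) \<le> exp (- ((\<kappa> - 1) * 1))"
      by simp
    then show ?thesis
      using C eL T by (intro mult_left_mono mult_mono) auto
  qed
  also have "exp (- ((\<kappa> - 1) * 1)) = 1 / (2 * C)"
    using C by (simp add: \<kappa>_def exp_minus inverse_eq_divide)
  also have "C * (T * (1 / (2 * C))) = T / 2"
    using C by simp
  finally have "T \<le> 2 * c * r powr (d + \<gamma> / 2) * (E / sqrt q)"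
    using le[OF r] by simp
  also have "r powr (d + \<gamma> / 2) = (8 * \<kappa>) powr ((2 * d + \<gamma>) / 4) * L powr ((2 * d + \<gamma>) / 4)"
  proof -
    have "r powr (d + \<gamma> / 2) = (r\<^sup>2) powr ((2 * d + \<gamma>) / 4)"
    proof -
      have e: "2 * ((2 * d + \<gamma>) / 4) = d + \<gamma> / 2" by (simp add: field_simps)
      show ?thesis
        using r powr_powr[of r 2 "(2 * d + \<gamma>) / 4", unfolded e] by simp
    qed
    then show ?thesis using \<kappa> L by (simp add: r2 powr_mult)
  qed
  finally have "sqrt q * T \<le> 2 * c * ((8 * \<kappa>) powr ((2 * d + \<gamma>) / 4) * L powr ((2 * d + \<gamma>) / 4)) * E"
    using q by (simp add: pos_le_divide_eq mult.commute)
  then have "sqrt q * T / L powr ((2 * d + \<gamma>) / 4) \<le> 2 * c * (8 * \<kappa>) powr ((2 * d + \<gamma>) / 4) * E"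
    using L by (simp add: pos_divide_le_eq mult_ac)
  \<comment> \<open>Since \<open>8 * \<kappa> \<ge> 1\<close>, the exponent may be raised to its
    value at \<open>\<gamma> = 2\<close>, which frees the constant of
    \<open>\<gamma>\<close>.\<close>
  also have "\<dots> \<le> 2 * c * (8 * \<kappa>) powr ((d + 1) / 2) * E"
    using c E \<kappa> d \<gamma> by (intro mult_right_mono mult_left_mono powr_mono) (auto simp: field_simps)
  finally show ?thesis by (simp add: L_def \<kappa>_def)
qed

section \<open>Distributions supported in the closed unit ball\<close>

lemma ball_distributionsD:
  assumes "\<mu> \<in> ball_distributions"
  shows "prob_space \<mu>" "sets \<mu> = sets borel" "AE x in \<mu>. norm x \<le> 1"
    "measure \<mu> (- cball 0 1) = 0"
proof -
  show \<mu>: "prob_space \<mu>" "sets \<mu> = sets borel"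
    using assms by (auto simp: ball_distributions_def)
  have *: "emeasure \<mu> (- cball 0 1) = 0"
    using assms support_subset_closed_iff[OF \<mu>(2), of "cball 0 1"]
    by (auto simp: ball_distributions_def)
  then show "measure \<mu> (- cball 0 1) = 0"
    by (simp add: measure_def)
  have "- cball 0 1 \<in> null_sets \<mu>"
    using * \<mu>(2) by (auto simp: null_sets_def)
  then show "AE x in \<mu>. norm x \<le> 1"
    by (rule AE_I') auto
qed

lemma integrable_norm_sq_ball_distributions:
  assumes "\<mu> \<in> ball_distributions"
  shows "integrable \<mu> (\<lambda>x. (norm x)\<^sup>2)"
proof -
  note \<mu> = ball_distributionsD[OF assms]
  interpret prob_space \<mu> by (rule \<mu>)
  note [measurable_cong] = \<mu>(2)
  show ?thesis
  proof (rule integrable_const_bound[of _ 1])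
    show "AE x in \<mu>. norm ((norm x)\<^sup>2) \<le> 1"
      using \<mu>(3) by eventually_elim (simp add: power_le_one)
  qed measurable
qed

section \<open>Smooth distributions\<close>

lemma fourier_eq_ft:
  fixes p :: "real ^ 'n \<Rightarrow> real"
  assumes [measurable]: "p \<in> borel_measurable borel" and p: "\<And>x. 0 \<le> p x"
  shows "fourier (\<lambda>x. of_real (p x)) = ft (density lborel (\<lambda>x. ennreal (p x)))"
proof
  fix \<omega> :: "real ^ 'n"
  have "ft (density lborel (\<lambda>x. ennreal (p x))) \<omega> = (LINT x|lborel. p x *\<^sub>R cis (- (x \<bullet> \<omega>)))"
    unfolding ft_def using p by (subst integral_density) auto
  then show "fourier (\<lambda>x. of_real (p x)) \<omega> = ft (density lborel (\<lambda>x. ennreal (p x))) \<omega>"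
    by (simp add: fourier_def cis_conv_exp scaleR_conv_of_real mult.commute)
qed

lemma smooth_distributionsD:
  fixes \<mu> :: "(real ^ 'n) measure"
  assumes "\<mu> \<in> smooth_distributions \<beta>"
  shows "\<mu> \<in> ball_distributions"
    "integrable lborel (\<lambda>\<omega>. norm \<omega> powr (2 * \<beta>) * (cmod (ft \<mu> \<omega>))\<^sup>2)"
    "(measure_sobolev_norm \<beta> \<mu>)\<^sup>2 = (LINT \<omega>|lborel. norm \<omega> powr (2 * \<beta>) * (cmod (ft \<mu> \<omega>))\<^sup>2)"
proof -
  from assms obtain p where p: "p \<in> borel_measurable borel" "\<And>x. 0 \<le> p x"
      "\<mu> = density lborel (\<lambda>x. ennreal (p x))" "has_sobolev_norm \<beta> p"
    and \<mu>: "\<mu> \<in> ball_distributions"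
    by (auto simp: smooth_distributions_def)
  note eq = fourier_eq_ft[OF p(1,2), folded p(3)]
  show "\<mu> \<in> ball_distributions" by fact
  show "integrable lborel (\<lambda>\<omega>. norm \<omega> powr (2 * \<beta>) * (cmod (ft \<mu> \<omega>))\<^sup>2)"
    using p(4) by (simp add: has_sobolev_norm_def eq)
  show "(measure_sobolev_norm \<beta> \<mu>)\<^sup>2 = (LINT \<omega>|lborel. norm \<omega> powr (2 * \<beta>) * (cmod (ft \<mu> \<omega>))\<^sup>2)"
    unfolding measure_sobolev_norm_density[OF p(1-3)] sobolev_norm_def eq
    by (intro real_sqrt_pow2 Bochner_Integration.integral_nonneg) auto
qed

text \<open>Square integrability of the transform difference is itself a conclusion: it is bounded
  on the ball and dominated by \<open>g\<close> outside. Both classes of distributions enter through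
  their choice of \<open>g\<close>.\<close>

lemma ft_diff_split_le:
  fixes \<mu> \<nu> :: "'a::euclidean_space measure"
  assumes \<mu>: "prob_space \<mu>" "sets \<mu> = sets borel" and \<nu>: "prob_space \<nu>" "sets \<nu> = sets borel"
    and g: "integrable lborel g" "\<And>\<omega>. 0 \<le> g \<omega>"
      "\<And>\<omega>. R < norm \<omega> \<Longrightarrow> (cmod (ft \<mu> \<omega> - ft \<nu> \<omega>))\<^sup>2 \<le> g \<omega>"
  shows "integrable lborel (\<lambda>\<omega>. (cmod (ft \<mu> \<omega> - ft \<nu> \<omega>))\<^sup>2)"
    and "(LINT \<omega>|lborel. (cmod (ft \<mu> \<omega> - ft \<nu> \<omega>))\<^sup>2)
      \<le> (LINT \<omega>|lborel. indicator (cball 0 R) \<omega> * (cmod (ft \<mu> \<omega> - ft \<nu> \<omega>))\<^sup>2) + (LINT \<omega>|lborel. g \<omega>)"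
proof -
  note [measurable] = ft_measurable[OF \<mu>] ft_measurable[OF \<nu>]
  note i = integrable_indicator_cball_ft_diff[OF \<mu> \<nu>, of R]
  have le: "(cmod (ft \<mu> \<omega> - ft \<nu> \<omega>))\<^sup>2
      \<le> indicator (cball 0 R) \<omega> * (cmod (ft \<mu> \<omega> - ft \<nu> \<omega>))\<^sup>2 + g \<omega>" for \<omega>
    using g(2,3)[of \<omega>] by (cases "R < norm \<omega>") auto
  show D: "integrable lborel (\<lambda>\<omega>. (cmod (ft \<mu> \<omega> - ft \<nu> \<omega>))\<^sup>2)"
    by (rule Bochner_Integration.integrable_bound[OF Bochner_Integration.integrable_add[OF i g(1)]])
       (use le g(2) in \<open>auto simp: abs_of_nonneg\<close>)
  have "(LINT \<omega>|lborel. (cmod (ft \<mu> \<omega> - ft \<nu> \<omega>))\<^sup>2)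
      \<le> (LINT \<omega>|lborel. indicator (cball 0 R) \<omega> * (cmod (ft \<mu> \<omega> - ft \<nu> \<omega>))\<^sup>2 + g \<omega>)"
    using D i g le by (intro integral_mono) auto
  then show "(LINT \<omega>|lborel. (cmod (ft \<mu> \<omega> - ft \<nu> \<omega>))\<^sup>2)
      \<le> (LINT \<omega>|lborel. indicator (cball 0 R) \<omega> * (cmod (ft \<mu> \<omega> - ft \<nu> \<omega>))\<^sup>2) + (LINT \<omega>|lborel. g \<omega>)"
    using i g by simp
qed

text \<open>For \<open>|\<omega>| > R\<close> the factor \<open>(|\<omega>| / R)\<close> to the
  power \<open>2 * \<beta>\<close> exceeds 1 and turns the tail into Sobolev norms. The ball of
  radius 2 is the support enlarged by the bump width 1.\<close>

lemma TV_smooth_le: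
  fixes \<mu> \<nu> :: "(real ^ 'n) measure"
  assumes \<beta>: "0 < \<beta>" and \<mu>S: "\<mu> \<in> smooth_distributions \<beta>" and \<nu>S: "\<nu> \<in> smooth_distributions \<beta>"
    and R: "0 < R"
  shows "(TV \<mu> \<nu>)\<^sup>2 \<le> 4 * measure lborel (cball (0::real^'n) 2) * (4 * pi\<^sup>2) powr (- real CARD('n) / 2) *
    ((LINT \<omega>|lborel. indicator (cball 0 R) \<omega> * (cmod (ft \<mu> \<omega> - ft \<nu> \<omega>))\<^sup>2)
      + 2 * R powr (- (2 * \<beta>)) * ((measure_sobolev_norm \<beta> \<mu>)\<^sup>2 + (measure_sobolev_norm \<beta> \<nu>)\<^sup>2))"
proof -
  note S\<mu> = smooth_distributionsD[OF \<mu>S] and S\<nu> = smooth_distributionsD[OF \<nu>S]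
  note \<mu> = ball_distributionsD[OF S\<mu>(1)] and \<nu> = ball_distributionsD[OF S\<nu>(1)]
  interpret M1: prob_space \<mu> by (rule \<mu>)
  interpret M2: prob_space \<nu> by (rule \<nu>)
  define g where "g \<omega> = 2 * R powr (- (2 * \<beta>)) *
    (norm \<omega> powr (2 * \<beta>) * (cmod (ft \<mu> \<omega>))\<^sup>2 + norm \<omega> powr (2 * \<beta>) * (cmod (ft \<nu> \<omega>))\<^sup>2)" for \<omega>
  have g1: "integrable lborel g"
    unfolding g_def using S\<mu>(2) S\<nu>(2) by simp
  have g0: "0 \<le> g \<omega>" for \<omega> by (simp add: g_def)
  have g2: "(cmod (ft \<mu> \<omega> - ft \<nu> \<omega>))\<^sup>2 \<le> g \<omega>" if "R < norm \<omega>" for \<omega>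
  proof -
    have "(cmod (ft \<mu> \<omega> - ft \<nu> \<omega>))\<^sup>2 \<le> (cmod (ft \<mu> \<omega>) + cmod (ft \<nu> \<omega>))\<^sup>2"
      by (intro power_mono norm_triangle_ineq4) auto
    also have "\<dots> \<le> 1 * (2 * (cmod (ft \<mu> \<omega>))\<^sup>2 + 2 * (cmod (ft \<nu> \<omega>))\<^sup>2)"
      using zero_le_power2[of "cmod (ft \<mu> \<omega>) - cmod (ft \<nu> \<omega>)"] by (simp add: power2_eq_square algebra_simps)
    also have "\<dots> \<le> (R powr (- (2 * \<beta>)) * norm \<omega> powr (2 * \<beta>)) * (2 * (cmod (ft \<mu> \<omega>))\<^sup>2 + 2 * (cmod (ft \<nu> \<omega>))\<^sup>2)"
    proof (rule mult_right_mono)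
      have "R powr (2 * \<beta>) \<le> norm \<omega> powr (2 * \<beta>)"
        using R that \<beta> by (intro powr_mono2) auto
      then show "1 \<le> R powr (- (2 * \<beta>)) * norm \<omega> powr (2 * \<beta>)"
        using R by (simp add: powr_minus field_simps)
    qed simp
    also have "\<dots> = g \<omega>" by (simp add: g_def algebra_simps)
    finally show ?thesis .
  qed
  note split = ft_diff_split_le[OF \<mu>(1,2) \<nu>(1,2) g1 g0 g2]
  have intg: "(LINT \<omega>|lborel. g \<omega>) = 2 * R powr (- (2 * \<beta>)) * ((measure_sobolev_norm \<beta> \<mu>)\<^sup>2 + (measure_sobolev_norm \<beta> \<nu>)\<^sup>2)"
    unfolding g_def S\<mu>(3) S\<nu>(3) using S\<mu>(2) S\<nu>(2) by simp
  define V where "V = measure lborel (cball (0::real^'n) 2)"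
  define c where "c = (4 * pi\<^sup>2) powr (- real CARD('n) / 2)"
  define W where "W = (LINT \<omega>|lborel. (cmod (ft \<mu> \<omega> - ft \<nu> \<omega>))\<^sup>2)"
  have W0: "0 \<le> W" unfolding W_def by simp
  have V0: "0 \<le> V" and c0: "0 \<le> c" by (auto simp: V_def c_def)
  have "TV \<mu> \<nu> \<le> 2 * sqrt (V * (c * W))"
  proof (rule TV_le)
    fix A assume A: "A \<in> sets \<mu>"
    \<comment> \<open>Cutting \<open>A\<close> to the unit ball loses no \<open>\<mu>\<close>-mass
      and can only decrease the \<open>\<nu>\<close>-mass, so the difference does not drop.\<close>
    have "measure \<mu> A \<le> measure \<mu> ((A \<inter> cball 0 1) \<union> - cball 0 1)"
      using A \<mu>(2) by (intro M1.finite_measure_mono) auto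
    also have "\<dots> \<le> measure \<mu> (A \<inter> cball 0 1) + measure \<mu> (- cball 0 1)"
      using A \<mu>(2) by (intro measure_Un_le) auto
    finally have "measure \<mu> A \<le> measure \<mu> (A \<inter> cball 0 1)" using \<mu>(4) by simp
    moreover have "measure \<nu> (A \<inter> cball 0 1) \<le> measure \<nu> A"
      using A \<mu>(2) \<nu>(2) by (intro M2.finite_measure_mono) auto
    moreover have "measure \<mu> (A \<inter> cball 0 1) - measure \<nu> (A \<inter> cball 0 1) \<le> 2 * sqrt (V * (c * W))"
      using measure_diff_le_sqrt[OF \<mu>(1,2) \<nu>(1,2) split(1), where A = "A \<inter> cball 0 1" and r = 1] A \<mu>(2)
      by (simp add: V_def c_def W_def)
    ultimately show "measure \<mu> A - measure \<nu> A \<le> 2 * sqrt (V * (c * W))" by linarith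
  qed
  then have "(TV \<mu> \<nu>)\<^sup>2 \<le> (2 * sqrt (V * (c * W)))\<^sup>2"
    using TV_nonneg[OF \<mu>(1) \<nu>(1)] by (intro power_mono)
  also have "\<dots> = 4 * V * c * W"
    using V0 c0 W0 by (simp add: power_mult_distrib)
  also have "\<dots> \<le> 4 * V * c * ((LINT \<omega>|lborel. indicator (cball 0 R) \<omega> * (cmod (ft \<mu> \<omega> - ft \<nu> \<omega>))\<^sup>2)
      + 2 * R powr (- (2 * \<beta>)) * ((measure_sobolev_norm \<beta> \<mu>)\<^sup>2 + (measure_sobolev_norm \<beta> \<nu>)\<^sup>2))"
    using V0 c0 split(2) unfolding W_def intg by (intro mult_left_mono) auto
  finally show ?thesis unfolding V_def c_def .
qed

lemma smooth_TV_le_energy_distance: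
  assumes \<beta>: "0 < \<beta>"
  shows "\<exists>C::real. \<forall>\<mu>\<in>smooth_distributions \<beta> :: (real ^ 'n) measure set.
            \<forall>\<nu>\<in>smooth_distributions \<beta>. \<forall>\<gamma>\<in>{0<..<2}.
              sqrt (\<gamma> * (2 - \<gamma>)) * TV \<mu> \<nu> powr ((2 * \<beta> + real CARD('n) + \<gamma>) / (2 * \<beta>))
              \<le> C * ((measure_sobolev_norm \<beta> \<mu>)\<^sup>2 + (measure_sobolev_norm \<beta> \<nu>)\<^sup>2)
                        powr ((real CARD('n) + \<gamma>) / (4 * \<beta>))
                   * energy_distance \<gamma> \<mu> \<nu>"
proof -
  define d where "d = real CARD('n)"
  define V where "V = 4 * measure lborel (cball (0::real^'n) 2) * (4 * pi\<^sup>2) powr (- d / 2)"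
  define K where "K = 16 * exp (1 / 4) * (8 * pi) powr (d / 2)"
  \<comment> \<open>Dominates the coefficients \<open>V * K\<close> of the energy term and
    \<open>V * 2\<close> of the tail; the added 1 gives \<open>B \<ge> 1\<close>, so powers of
    \<open>2 * B\<close> increase with the exponent.\<close>
  define B where "B = V * (K + 2) + 1"
  have d: "1 \<le> d" by (simp add: d_def)
  have V: "0 \<le> V" by (simp add: V_def)
  have K: "0 \<le> K" by (simp add: K_def)
  have B: "1 \<le> B" "V * K \<le> B" "V * 2 \<le> B" using V K by (auto simp: B_def algebra_simps)
  show ?thesis
  proof (intro exI ballI)
    fix \<mu> \<nu> :: "(real ^ 'n) measure" and \<gamma> :: real
    assume \<mu>S: "\<mu> \<in> smooth_distributions \<beta>" and \<nu>S: "\<nu> \<in> smooth_distributions \<beta>"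
      and "\<gamma> \<in> {0<..<2}"
    then have \<gamma>: "0 < \<gamma>" "\<gamma> < 2" by auto
    note S\<mu> = smooth_distributionsD[OF \<mu>S] and S\<nu> = smooth_distributionsD[OF \<nu>S]
    note \<mu> = ball_distributionsD[OF S\<mu>(1)] and \<nu> = ball_distributionsD[OF S\<nu>(1)]
    note m = integrable_norm_sq_ball_distributions[OF S\<mu>(1)] integrable_norm_sq_ball_distributions[OF S\<nu>(1)]
    define S where "S = (measure_sobolev_norm \<beta> \<mu>)\<^sup>2 + (measure_sobolev_norm \<beta> \<nu>)\<^sup>2"
    define E where "E = energy_distance \<gamma> \<mu> \<nu>"
    define q where "q = \<gamma> * (2 - \<gamma>)"
    have q: "0 < q" using \<gamma> by (simp add: q_def)
    have S: "0 \<le> S" by (simp add: S_def)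
    have E: "0 \<le> E"
      unfolding E_def by (rule energy_distance_nonneg[OF \<mu>(1,2) \<nu>(1,2) m \<gamma> zero_less_one])
    have "sqrt q * TV \<mu> \<nu> powr ((2 * \<beta> + (d + \<gamma>)) / (2 * \<beta>))
       \<le> (2 * B) powr ((2 * \<beta> + (d + \<gamma>)) / (2 * (2 * \<beta>))) * S powr ((d + \<gamma>) / (2 * (2 * \<beta>))) * E"
    proof (rule powr_interpolation[OF TV_nonneg[OF \<mu>(1) \<nu>(1)] _ q E S])
      fix R :: real assume R: "0 < R"
      let ?I = "LINT \<omega>|lborel. indicator (cball 0 R) \<omega> * (cmod (ft \<mu> \<omega> - ft \<nu> \<omega>))\<^sup>2"
      have "q * ?I \<le> K * R powr (d + \<gamma>) * E\<^sup>2"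
        using ft_diff_ball_le_energy_distance[OF \<mu>(1,2) \<nu>(1,2) m \<gamma> R]
        by (simp add: q_def K_def d_def E_def)
      then have I: "?I \<le> K * (R powr (d + \<gamma>) * (E\<^sup>2 / q))"
        using q by (simp add: pos_le_divide_eq mult_ac)
      have "(TV \<mu> \<nu>)\<^sup>2 \<le> V * (?I + 2 * R powr (- (2 * \<beta>)) * S)"
        using TV_smooth_le[OF \<beta> \<mu>S \<nu>S R] by (simp add: V_def S_def d_def)
      also have "\<dots> \<le> V * (K * (R powr (d + \<gamma>) * (E\<^sup>2 / q)) + 2 * R powr (- (2 * \<beta>)) * S)"
        using V I by (intro mult_left_mono) auto
      also have "\<dots> = (V * K) * (R powr (d + \<gamma>) * (E\<^sup>2 / q)) + (V * 2) * (R powr (- (2 * \<beta>)) * S)"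
        by (simp add: algebra_simps)
      also have "\<dots> \<le> B * (R powr (d + \<gamma>) * (E\<^sup>2 / q)) + B * (R powr (- (2 * \<beta>)) * S)"
        using B q S by (intro add_mono mult_right_mono) auto
      finally show "(TV \<mu> \<nu>)\<^sup>2 \<le> B * (R powr (d + \<gamma>) * (E\<^sup>2 / q) + R powr (- (2 * \<beta>)) * S)"
        by (simp add: algebra_simps)
    qed (use B \<beta> d \<gamma> in auto)
    \<comment> \<open>The exponent of the constant is raised to its value at
      \<open>\<gamma> = 2\<close>, so that the constant depends on \<open>\<beta>\<close> and the
      dimension only.\<close>
    also have "\<dots> \<le> (2 * B) powr ((2 * \<beta> + (d + 2)) / (2 * (2 * \<beta>))) * S powr ((d + \<gamma>) / (2 * (2 * \<beta>))) * E"
      using B E \<beta> \<gamma> by (intro mult_right_mono powr_mono divide_right_mono) auto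
    finally show "sqrt (\<gamma> * (2 - \<gamma>)) * TV \<mu> \<nu> powr ((2 * \<beta> + real CARD('n) + \<gamma>) / (2 * \<beta>))
              \<le> (2 * B) powr ((2 * \<beta> + (d + 2)) / (2 * (2 * \<beta>))) * ((measure_sobolev_norm \<beta> \<mu>)\<^sup>2 + (measure_sobolev_norm \<beta> \<nu>)\<^sup>2)
                        powr ((real CARD('n) + \<gamma>) / (4 * \<beta>))
                   * energy_distance \<gamma> \<mu> \<nu>"
      by (simp add: q_def S_def E_def d_def add.assoc)
  qed
qed

section \<open>Gaussian mixtures\<close>

lemma std_gaussian_eq_gauss: "std_gaussian = density lborel (\<lambda>x::real^'n. ennreal (gauss 1 x))"
  by (simp add: std_gaussian_def gauss_def)

lemma prob_space_std_gaussian: "prob_space (std_gaussian :: (real^'n) measure)"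
  unfolding std_gaussian_eq_gauss by (rule prob_space_gauss) simp

lemma sets_std_gaussian [simp, measurable_cong]: "sets (std_gaussian :: (real^'n) measure) = sets borel"
  by (simp add: std_gaussian_def)

lemma ft_std_gaussian:
  "ft std_gaussian (\<omega> :: real^'n) = exp (- (norm \<omega>)\<^sup>2 / 2)"
proof -
  have "ft std_gaussian \<omega> = (LINT x|lborel. gauss 1 x *\<^sub>R cis (- (x \<bullet> \<omega>)))"
    unfolding ft_def std_gaussian_eq_gauss by (subst integral_density) auto
  also have "\<dots> = (LINT x|lborel. cis (- \<omega> \<bullet> x) * gauss 1 x)"
    by (simp add: scaleR_conv_of_real mult.commute inner_commute)
  also have "\<dots> = exp (- (norm \<omega>)\<^sup>2 / 2)"
    using integral_gauss_cis[of 1 "- \<omega>"] by simp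
  finally show ?thesis .
qed

lemma norm_add_sq_le: "(norm (x + y :: 'a::real_normed_vector))\<^sup>2 \<le> 2 * (norm x)\<^sup>2 + 2 * (norm y)\<^sup>2"
proof -
  have "(norm (x + y))\<^sup>2 \<le> (norm x + norm y)\<^sup>2"
    by (intro power_mono norm_triangle_ineq) auto
  also have "\<dots> \<le> 2 * (norm x)\<^sup>2 + 2 * (norm y)\<^sup>2"
    using zero_le_power2[of "norm x - norm y"] by (simp add: power2_eq_square algebra_simps)
  finally show ?thesis .
qed

text \<open>The tilt by \<open>exp (|y|^2 / 4)\<close> turns variance 1 into variance 2; the value
  is the ratio of the two normalising constants.\<close>

lemma nn_integral_std_gaussian_exp:
  "(\<integral>\<^sup>+y. ennreal (exp ((norm y)\<^sup>2 / 4)) \<partial>(std_gaussian :: (real^'n) measure))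
    = ennreal (2 powr (real CARD('n) / 2))"
proof -
  let ?p = "real CARD('n) / 2"
  have eq: "gauss 1 y * exp ((norm y)\<^sup>2 / 4) = 2 powr ?p * gauss (sqrt 2) y" for y :: "real^'n"
  proof -
    have "(2 * pi) powr (- ?p) = 2 powr ?p * (2 * pi * 2) powr (- ?p)"
      by (simp add: powr_mult powr_minus field_simps powr_add[symmetric])
    moreover have "- (norm y)\<^sup>2 / 2 + (norm y)\<^sup>2 / 4 = - (norm y)\<^sup>2 / 4"
      by simp
    then have "exp (- (norm y)\<^sup>2 / 2) * exp ((norm y)\<^sup>2 / 4) = exp (- (norm y)\<^sup>2 / 4)"
      by (simp only: exp_add[symmetric])
    ultimately show ?thesis
      by (simp add: gauss_def mult.assoc)
  qed
  have "(\<integral>\<^sup>+y. ennreal (exp ((norm y)\<^sup>2 / 4)) \<partial>(std_gaussian :: (real^'n) measure))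
      = (\<integral>\<^sup>+y. ennreal (gauss 1 y) * ennreal (exp ((norm y)\<^sup>2 / 4)) \<partial>(lborel :: (real^'n) measure))"
    unfolding std_gaussian_eq_gauss by (rule nn_integral_density) measurable
  also have "\<dots> = (\<integral>\<^sup>+y. ennreal (2 powr ?p) * ennreal (gauss (sqrt 2) y) \<partial>(lborel :: (real^'n) measure))"
    by (simp only: ennreal_mult[symmetric] eq gauss_nonneg exp_ge_zero powr_ge_zero)
  also have "\<dots> = ennreal (2 powr ?p)"
    by (subst nn_integral_cmult) (simp_all add: nn_integral_gauss)
  finally show ?thesis .
qed

text \<open>Convolution multiplies transforms, so the Gaussian factor bounds
  \<open>ft \<mu>\<close>. For the moment, \<open>|x + y|^2 \<le> 2 |x|^2 + 2 |y|^2\<close> and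
  \<open>|x| \<le> 1\<close> reduce rate \<open>1 / 8\<close> for the mixture to rate
  \<open>1 / 4\<close> for the noise, safely below its critical rate \<open>1 / 2\<close>.\<close>

lemma gaussian_mixturesD:
  fixes \<mu> :: "(real ^ 'n) measure"
  assumes "\<mu> \<in> gaussian_mixtures"
  shows "prob_space \<mu>" "sets \<mu> = sets borel"
    "cmod (ft \<mu> \<omega>) \<le> exp (- (norm \<omega>)\<^sup>2 / 2)"
    "integrable \<mu> (\<lambda>x. exp ((norm x)\<^sup>2 / 8))"
    "(LINT x|\<mu>. exp ((norm x)\<^sup>2 / 8)) \<le> exp (1 / 4) * 2 powr (real CARD('n) / 2)"
proof -
  from assms obtain \<rho> where \<mu>: "\<mu> = (\<rho> \<star> std_gaussian)" and \<rho>B: "\<rho> \<in> ball_distributions"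
    by (auto simp: gaussian_mixtures_def)
  note \<rho> = ball_distributionsD[OF \<rho>B]
  let ?N = "std_gaussian :: (real^'n) measure"
  interpret M1: prob_space \<rho> by (rule \<rho>)
  interpret M2: prob_space ?N by (rule prob_space_std_gaussian)
  interpret PQ: pair_prob_space \<rho> ?N ..
  note [measurable_cong] = \<rho>(2)
  have T: "(\<lambda>(x, y). x + y) \<in> measurable (\<rho> \<Otimes>\<^sub>M ?N) borel" by measurable
  show P: "prob_space \<mu>"
    unfolding \<mu> convolution_def by (rule PQ.prob_space_distr[OF T])
  show [measurable_cong]: "sets \<mu> = sets borel"
    by (simp add: \<mu>)
  have "ft \<mu> \<omega> = (LINT z|(\<rho> \<Otimes>\<^sub>M ?N). cis (- ((case z of (x, y) \<Rightarrow> x + y) \<bullet> \<omega>)))"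
    unfolding ft_def \<mu> convolution_def by (rule integral_distr[OF T]) measurable
  also have "\<dots> = (LINT z|(\<rho> \<Otimes>\<^sub>M ?N). cis (- (fst z \<bullet> \<omega>)) * cis (- (snd z \<bullet> \<omega>)))"
    by (intro Bochner_Integration.integral_cong) (auto simp: cis_mult inner_add_left)
  also have "\<dots> = (LINT x|\<rho>. LINT y|?N. cis (- (x \<bullet> \<omega>)) * cis (- (y \<bullet> \<omega>)))"
    by (subst PQ.integral_fst'[symmetric])
       (auto intro!: integrable_bounded_prob[of _ _ 1] simp: norm_mult PQ.prob_space_axioms)
  also have "\<dots> = ft \<rho> \<omega> * ft ?N \<omega>"
    by (simp add: ft_def)
  finally have "cmod (ft \<mu> \<omega>) = cmod (ft \<rho> \<omega>) * exp (- (norm \<omega>)\<^sup>2 / 2)"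
    by (simp add: ft_std_gaussian norm_mult del: of_real_exp)
  then show "cmod (ft \<mu> \<omega>) \<le> exp (- (norm \<omega>)\<^sup>2 / 2)"
    using norm_ft_le_1[OF \<rho>(1), of \<omega>] by (simp add: mult_left_le_one_le)
  have "(\<integral>\<^sup>+x. ennreal (exp ((norm x)\<^sup>2 / 8)) \<partial>\<mu>)
      = (\<integral>\<^sup>+x. \<integral>\<^sup>+y. ennreal (exp ((norm (x + y))\<^sup>2 / 8)) \<partial>?N \<partial>\<rho>)"
    unfolding \<mu> by (rule nn_integral_convolution)
      (use \<rho>(2) in \<open>auto simp: M1.finite_measure_axioms M2.finite_measure_axioms\<close>)
  also have "\<dots> \<le> (\<integral>\<^sup>+x. \<integral>\<^sup>+y. ennreal (exp (1 / 4)) * ennreal (exp ((norm y)\<^sup>2 / 4)) \<partial>?N \<partial>\<rho>)"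
  proof (intro nn_integral_mono_AE)
    show "AE x in \<rho>. (\<integral>\<^sup>+y. ennreal (exp ((norm (x + y))\<^sup>2 / 8)) \<partial>?N)
      \<le> (\<integral>\<^sup>+y. ennreal (exp (1 / 4)) * ennreal (exp ((norm y)\<^sup>2 / 4)) \<partial>?N)"
      using \<rho>(3)
    proof eventually_elim
      case (elim x)
      have "exp ((norm (x + y))\<^sup>2 / 8) \<le> exp (1 / 4) * exp ((norm y)\<^sup>2 / 4)" for y
      proof -
        have "(norm x)\<^sup>2 \<le> 1" using elim by (simp add: power_le_one)
        then have "(norm (x + y))\<^sup>2 / 8 \<le> 1 / 4 + (norm y)\<^sup>2 / 4"
          using norm_add_sq_le[of x y] by linarith
        then show ?thesis by (simp add: exp_add[symmetric])
      qed
      then show ?case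
        by (intro nn_integral_mono) (simp add: ennreal_mult[symmetric] ennreal_leI)
    qed
  qed
  also have "\<dots> = ennreal (exp (1 / 4) * 2 powr (real CARD('n) / 2))"
    by (simp add: nn_integral_cmult nn_integral_std_gaussian_exp M1.emeasure_space_1 ennreal_mult)
  finally have *: "(\<integral>\<^sup>+x. ennreal (exp ((norm x)\<^sup>2 / 8)) \<partial>\<mu>)
      \<le> ennreal (exp (1 / 4) * 2 powr (real CARD('n) / 2))" .
  have m: "(\<lambda>x. exp ((norm x)\<^sup>2 / 8)) \<in> borel_measurable \<mu>"
    by measurable
  show "integrable \<mu> (\<lambda>x. exp ((norm x)\<^sup>2 / 8))"
    using m le_less_trans[OF * ennreal_less_top] by (simp add: integrable_iff_bounded)
  show "(LINT x|\<mu>. exp ((norm x)\<^sup>2 / 8)) \<le> exp (1 / 4) * 2 powr (real CARD('n) / 2)"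
    using m * by (simp add: integral_eq_nn_integral enn2real_leI)
qed

text \<open>Both parts use the exponential moment: \<open>u \<le> exp u\<close> for the second
  moment, a Chernoff bound for the tail.\<close>

lemma gaussian_mixtures_tail:
  fixes \<mu> :: "(real ^ 'n) measure"
  assumes \<mu>G: "\<mu> \<in> gaussian_mixtures" and r: "0 \<le> r"
  shows "integrable \<mu> (\<lambda>x. (norm x)\<^sup>2)"
    and "measure \<mu> (- cball 0 r) \<le> exp (1 / 4) * 2 powr (real CARD('n) / 2) * exp (- r\<^sup>2 / 8)"
proof -
  note \<mu> = gaussian_mixturesD[OF \<mu>G]
  note [measurable_cong] = \<mu>(2)
  interpret prob_space \<mu> by (rule \<mu>)
  show "integrable \<mu> (\<lambda>x. (norm x)\<^sup>2)"
  proof (rule Bochner_Integration.integrable_bound)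
    show "integrable \<mu> (\<lambda>x. 8 * exp ((norm x)\<^sup>2 / 8))"
      using \<mu>(4) by simp
    show "AE x in \<mu>. norm ((norm x)\<^sup>2) \<le> norm (8 * exp ((norm x)\<^sup>2 / 8))"
    proof (rule AE_I2)
      fix x :: "real^'n"
      have "(norm x)\<^sup>2 \<le> 8 * exp ((norm x)\<^sup>2 / 8)"
        using exp_ge_add_one_self[of "(norm x)\<^sup>2 / 8"] by linarith
      then show "norm ((norm x)\<^sup>2) \<le> norm (8 * exp ((norm x)\<^sup>2 / 8))"
        by simp
    qed
  qed measurable
  have S: "- cball 0 r \<in> sets \<mu>" using \<mu>(2) by simp
  have "measure \<mu> (- cball 0 r) * exp (r\<^sup>2 / 8) = (LINT x|\<mu>. indicator (- cball 0 r) x * exp (r\<^sup>2 / 8))"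
    using S by simp
  also have "\<dots> \<le> (LINT x|\<mu>. exp ((norm x)\<^sup>2 / 8))"
  proof (rule integral_mono)
    show "integrable \<mu> (\<lambda>x. indicator (- cball 0 r) x * exp (r\<^sup>2 / 8))"
      using S by (intro integrable_mult_left integrable_real_indicator) (auto simp: emeasure_eq_measure)
    show "indicator (- cball 0 r) x * exp (r\<^sup>2 / 8) \<le> exp ((norm x)\<^sup>2 / 8)" for x :: "real^'n"
    proof (cases "r < norm x")
      case True
      then have "r\<^sup>2 \<le> (norm x)\<^sup>2" using r by (intro power_mono) auto
      then show ?thesis using True by simp
    qed simp
  qed (rule \<mu>)
  also have "\<dots> \<le> exp (1 / 4) * 2 powr (real CARD('n) / 2)" by (rule \<mu>)
  finally show "measure \<mu> (- cball 0 r) \<le> exp (1 / 4) * 2 powr (real CARD('n) / 2) * exp (- r\<^sup>2 / 8)"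
    by (simp add: exp_minus field_simps)
qed

text \<open>One radius truncates space and frequency. As mixtures have unbounded support, the
  spatial cut leaves the tail of \<open>\<mu>\<close> as the first summand.\<close>

lemma TV_gaussian_mixtures_le:
  fixes \<mu> \<nu> :: "(real ^ 'n) measure"
  assumes \<mu>G: "\<mu> \<in> gaussian_mixtures" and \<nu>G: "\<nu> \<in> gaussian_mixtures" and r: "0 \<le> r"
  shows "TV \<mu> \<nu> \<le> exp (1 / 4) * 2 powr (real CARD('n) / 2) * exp (- r\<^sup>2 / 8)
    + 2 * sqrt (measure lborel (cball (0::real^'n) (r + 1)) * ((4 * pi\<^sup>2) powr (- real CARD('n) / 2)
      * ((LINT \<omega>|lborel. indicator (cball 0 r) \<omega> * (cmod (ft \<mu> \<omega> - ft \<nu> \<omega>))\<^sup>2)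
          + 4 * (2 * pi) powr (real CARD('n) / 2) * exp (- r\<^sup>2 / 2))))"
proof (rule TV_le)
  note \<mu> = gaussian_mixturesD[OF \<mu>G] and \<nu> = gaussian_mixturesD[OF \<nu>G]
  interpret M1: prob_space \<mu> by (rule \<mu>)
  interpret M2: prob_space \<nu> by (rule \<nu>)
  \<comment> \<open>Outside the ball the squared difference is at most
    \<open>4 * exp (- |\<omega>|^2)\<close>. Half of the exponent yields
    \<open>exp (- r\<^sup>2 / 2)\<close>; the other half is a Gaussian of total mass
    \<open>(2 * pi) powr (d / 2)\<close>.\<close>
  let ?c = "4 * (2 * pi) powr (real CARD('n) / 2) * exp (- r\<^sup>2 / 2)"
  have g: "integrable lborel (\<lambda>\<omega>. ?c * gauss 1 (\<omega>::real^'n))"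
    by (intro integrable_mult_right integrable_gauss) simp
  have g0: "0 \<le> ?c * gauss 1 \<omega>" for \<omega> :: "real^'n" by simp
  have g2: "(cmod (ft \<mu> \<omega> - ft \<nu> \<omega>))\<^sup>2 \<le> ?c * gauss 1 \<omega>" if "r < norm \<omega>" for \<omega>
  proof -
    have "cmod (ft \<mu> \<omega> - ft \<nu> \<omega>) \<le> 2 * exp (- (norm \<omega>)\<^sup>2 / 2)"
      using norm_triangle_ineq4[of "ft \<mu> \<omega>" "ft \<nu> \<omega>"] \<mu>(3)[of \<omega>] \<nu>(3)[of \<omega>] by linarith
    then have "(cmod (ft \<mu> \<omega> - ft \<nu> \<omega>))\<^sup>2 \<le> (2 * exp (- (norm \<omega>)\<^sup>2 / 2))\<^sup>2"
      by (intro power_mono) auto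
    also have "\<dots> = 4 * exp (- (norm \<omega>)\<^sup>2 / 2) * exp (- (norm \<omega>)\<^sup>2 / 2)"
      by (simp add: power2_eq_square)
    also have "\<dots> \<le> 4 * exp (- r\<^sup>2 / 2) * exp (- (norm \<omega>)\<^sup>2 / 2)"
    proof -
      have "r\<^sup>2 \<le> (norm \<omega>)\<^sup>2" using that r by (intro power_mono) auto
      then show ?thesis by simp
    qed
    also have "\<dots> = ?c * gauss 1 \<omega>"
      by (simp add: gauss_def powr_minus field_simps)
    finally show ?thesis .
  qed
  note split = ft_diff_split_le[OF \<mu>(1,2) \<nu>(1,2) g g0 g2]
  define V where "V = measure lborel (cball (0::real^'n) (r + 1))"
  define c where "c = (4 * pi\<^sup>2) powr (- real CARD('n) / 2)"
  let ?W = "LINT \<omega>|lborel. (cmod (ft \<mu> \<omega> - ft \<nu> \<omega>))\<^sup>2"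
  let ?I = "LINT \<omega>|lborel. indicator (cball 0 r) \<omega> * (cmod (ft \<mu> \<omega> - ft \<nu> \<omega>))\<^sup>2"
  have W: "?W \<le> ?I + ?c"
    using split(2) integral_gauss[where 'a = "real^'n", of 1] by simp
  fix A assume A: "A \<in> sets \<mu>"
  have "measure \<mu> A \<le> measure \<mu> ((A \<inter> cball 0 r) \<union> - cball 0 r)"
    using A \<mu>(2) by (intro M1.finite_measure_mono) auto
  also have "\<dots> \<le> measure \<mu> (A \<inter> cball 0 r) + measure \<mu> (- cball 0 r)"
    using A \<mu>(2) by (intro measure_Un_le) auto
  finally have "measure \<mu> A \<le> measure \<mu> (A \<inter> cball 0 r) + measure \<mu> (- cball 0 r)" .
  moreover have "measure \<nu> (A \<inter> cball 0 r) \<le> measure \<nu> A"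
    using A \<mu>(2) \<nu>(2) by (intro M2.finite_measure_mono) auto
  moreover have "measure \<mu> (A \<inter> cball 0 r) - measure \<nu> (A \<inter> cball 0 r) \<le> 2 * sqrt (V * (c * ?W))"
    using measure_diff_le_sqrt[OF \<mu>(1,2) \<nu>(1,2) split(1), where A = "A \<inter> cball 0 r" and r = r] A \<mu>(2) r
    by (simp add: V_def c_def)
  moreover have "sqrt (V * (c * ?W)) \<le> sqrt (V * (c * (?I + ?c)))"
    using W by (intro real_sqrt_le_mono mult_left_mono) (auto simp: V_def c_def)
  ultimately show "measure \<mu> A - measure \<nu> A \<le> exp (1 / 4) * 2 powr (real CARD('n) / 2) * exp (- r\<^sup>2 / 8)
    + 2 * sqrt (measure lborel (cball (0::real^'n) (r + 1)) * ((4 * pi\<^sup>2) powr (- real CARD('n) / 2)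
      * (?I + ?c)))"
    using gaussian_mixtures_tail(2)[OF \<mu>G r] unfolding V_def c_def by linarith
qed

lemma gaussian_mixtures_TV_le_energy_distance:
  "\<exists>C::real. \<forall>\<mu>\<in>gaussian_mixtures :: (real ^ 'n) measure set.
            \<forall>\<nu>\<in>gaussian_mixtures. \<forall>\<gamma>\<in>{0<..<2}.
              sqrt (\<gamma> * (2 - \<gamma>)) * TV \<mu> \<nu>
                / ln (3 + 1 / TV \<mu> \<nu>) powr ((2 * real CARD('n) + \<gamma>) / 4)
              \<le> C * energy_distance \<gamma> \<mu> \<nu>"
proof -
  define d where "d = real CARD('n)"
  define V where "V = 2 ^ CARD('n) * measure lborel (cball (0::real^'n) 1) * (4 * pi\<^sup>2) powr (- d / 2)"
  define K where "K = 16 * exp (1 / 4) * (8 * pi) powr (d / 2)"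
  define G where "G = 4 * (2 * pi) powr (d / 2)"
  define M where "M = exp (1 / 4) * 2 powr (d / 2)"
  \<comment> \<open>Collects the spatial and the frequency tail, both at rate
    \<open>exp (- r\<^sup>2 / 8)\<close>. The maximum with 1 meets the requirement of
    \<open>log_interpolation\<close>.\<close>
  define C where "C = max 1 (M + 2 * sqrt (V * G) * exp (d\<^sup>2 / 2))"
  define c where "c = 2 * sqrt (V * K)"
  have d: "1 \<le> d" by (simp add: d_def)
  have nn: "0 \<le> V" "0 \<le> K" "0 \<le> G" "0 \<le> M" by (auto simp: V_def K_def G_def M_def)
  show ?thesis
  proof (intro exI ballI)
    fix \<mu> \<nu> :: "(real ^ 'n) measure" and \<gamma> :: real
    assume \<mu>G: "\<mu> \<in> gaussian_mixtures" and \<nu>G: "\<nu> \<in> gaussian_mixtures" and "\<gamma> \<in> {0<..<2}"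
    then have \<gamma>: "0 < \<gamma>" "\<gamma> < 2" by auto
    note \<mu> = gaussian_mixturesD[OF \<mu>G] and \<nu> = gaussian_mixturesD[OF \<nu>G]
    note m = gaussian_mixtures_tail(1)[OF \<mu>G order_refl] gaussian_mixtures_tail(1)[OF \<nu>G order_refl]
    define E where "E = energy_distance \<gamma> \<mu> \<nu>"
    define q where "q = \<gamma> * (2 - \<gamma>)"
    have q: "0 < q" using \<gamma> by (simp add: q_def)
    have E: "0 \<le> E"
      unfolding E_def by (rule energy_distance_nonneg[OF \<mu>(1,2) \<nu>(1,2) m \<gamma> zero_less_one])
    have "sqrt q * TV \<mu> \<nu> / ln (3 + 1 / TV \<mu> \<nu>) powr ((2 * d + \<gamma>) / 4)
      \<le> 2 * c * (8 * (1 + ln (2 * C))) powr ((d + 1) / 2) * E"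
    proof (rule log_interpolation[OF TV_nonneg[OF \<mu>(1) \<nu>(1)] _ _ q E])
      fix r :: real assume r: "1 \<le> r"
      let ?I = "LINT \<omega>|lborel. indicator (cball 0 r) \<omega> * (cmod (ft \<mu> \<omega> - ft \<nu> \<omega>))\<^sup>2"
      have "q * ?I \<le> K * R" if "R = r powr (d + \<gamma>) * E\<^sup>2" for R
        using ft_diff_ball_le_energy_distance[OF \<mu>(1,2) \<nu>(1,2) m \<gamma>, of r] r
        by (simp add: q_def K_def d_def E_def that mult_ac)
      then have I: "?I \<le> K * (r powr (d + \<gamma>) * (E\<^sup>2 / q))"
        using q by (simp add: pos_le_divide_eq mult_ac)
      have "measure lborel (cball (0::real^'n) (r + 1)) = measure lborel (cball (0::real^'n) 1) * (r + 1) ^ CARD('n)"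
        using r by (simp add: content_cball)
      \<comment> \<open>From \<open>r \<ge> 1\<close> follows \<open>r + 1 \<le> 2 * r\<close>, the
        source of the power of 2 in \<open>V\<close>.\<close>
      also have "\<dots> \<le> measure lborel (cball (0::real^'n) 1) * (2 * r) ^ CARD('n)"
        using r by (intro mult_left_mono power_mono) auto
      also have "\<dots> = 2 ^ CARD('n) * measure lborel (cball (0::real^'n) 1) * r powr d"
        using r by (simp add: power_mult_distrib powr_realpow d_def)
      finally have vol: "measure lborel (cball (0::real^'n) (r + 1)) * (4 * pi\<^sup>2) powr (- d / 2) \<le> V * r powr d"
        unfolding V_def by (simp add: mult_right_mono mult_ac)
      have I0: "0 \<le> ?I" by (intro Bochner_Integration.integral_nonneg) simp
      have "TV \<mu> \<nu> \<le> M * exp (- r\<^sup>2 / 8) + 2 * sqrt (measure lborel (cball (0::real^'n) (r + 1))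
          * ((4 * pi\<^sup>2) powr (- d / 2) * (?I + G * exp (- r\<^sup>2 / 2))))"
        using TV_gaussian_mixtures_le[OF \<mu>G \<nu>G, of r] r by (simp add: M_def G_def d_def)
      also have "sqrt (measure lborel (cball (0::real^'n) (r + 1))
          * ((4 * pi\<^sup>2) powr (- d / 2) * (?I + G * exp (- r\<^sup>2 / 2))))
          \<le> sqrt (V * r powr d * (K * (r powr (d + \<gamma>) * (E\<^sup>2 / q)) + G * exp (- r\<^sup>2 / 2)))"
        unfolding mult.assoc[symmetric, of "measure lborel (cball (0::real^'n) (r + 1))"]
        by (intro real_sqrt_le_mono mult_mono[OF vol] add_right_mono I add_nonneg_nonneg I0)
          (use nn in auto)
      also have "\<dots> = sqrt (V * K * (r powr d * r powr (d + \<gamma>)) * (E\<^sup>2 / q) + V * G * (r powr d * exp (- r\<^sup>2 / 2)))"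
        by (simp add: algebra_simps)
      also have "\<dots> \<le> sqrt (V * K * (r powr d * r powr (d + \<gamma>)) * (E\<^sup>2 / q)) + sqrt (V * G * (r powr d * exp (- r\<^sup>2 / 2)))"
        using nn q by (intro sqrt_add_le_add_sqrt mult_nonneg_nonneg) auto
      \<comment> \<open>Volume growth and frequency growth combine here to
        \<open>r powr (d + \<gamma> / 2)\<close>.\<close>
      also have "sqrt (V * K * (r powr d * r powr (d + \<gamma>)) * (E\<^sup>2 / q)) = sqrt (V * K) * r powr (d + \<gamma> / 2) * (E / sqrt q)"
      proof -
        have "r powr d * r powr (d + \<gamma>) = (r powr (d + \<gamma> / 2))\<^sup>2"
          by (simp add: power2_eq_square powr_add[symmetric])
        then show ?thesis
          using E by (simp add: real_sqrt_mult real_sqrt_divide)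
      qed
      also have "sqrt (V * G * (r powr d * exp (- r\<^sup>2 / 2))) = sqrt (V * G) * (r powr (d / 2) * exp (- r\<^sup>2 / 4))"
      proof -
        have "r powr d * exp (- r\<^sup>2 / 2) = (r powr (d / 2) * exp (- r\<^sup>2 / 4))\<^sup>2"
          by (simp add: power_mult_distrib power2_eq_square[of "_ powr _"] power2_eq_square[of "exp _"]
              powr_add[symmetric] exp_add[symmetric])
        then show ?thesis by (simp add: real_sqrt_mult)
      qed
      also have "r powr (d / 2) * exp (- r\<^sup>2 / 4) \<le> exp (d\<^sup>2 / 2) * exp (- r\<^sup>2 / 8)"
      proof -
        have "r powr (d / 2) * exp (- r\<^sup>2 / 4) \<le> exp (d\<^sup>2 / 2) * exp (r\<^sup>2 / 8) * exp (- r\<^sup>2 / 4)"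
          using r d by (intro mult_right_mono powr_le_exp_sq) auto
        also have "\<dots> = exp (d\<^sup>2 / 2) * exp (- r\<^sup>2 / 8)"
          by (simp add: mult.assoc exp_add[symmetric])
        finally show ?thesis .
      qed
      finally have "TV \<mu> \<nu> \<le> M * exp (- r\<^sup>2 / 8) + 2 * (sqrt (V * K) * r powr (d + \<gamma> / 2) * (E / sqrt q)
          + sqrt (V * G) * (exp (d\<^sup>2 / 2) * exp (- r\<^sup>2 / 8)))"
        using nn by (simp add: mult_left_mono)
      also have "\<dots> = (M + 2 * sqrt (V * G) * exp (d\<^sup>2 / 2)) * exp (- r\<^sup>2 / 8) + c * r powr (d + \<gamma> / 2) * (E / sqrt q)"
        by (simp add: c_def algebra_simps)
      also have "\<dots> \<le> C * exp (- r\<^sup>2 / 8) + c * r powr (d + \<gamma> / 2) * (E / sqrt q)"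
        by (intro add_right_mono mult_right_mono) (auto simp: C_def)
      finally show "TV \<mu> \<nu> \<le> C * exp (- r\<^sup>2 / 8) + c * r powr (d + \<gamma> / 2) * (E / sqrt q)" .
    qed (use nn d \<gamma> in \<open>auto simp: C_def c_def\<close>)
    then show "sqrt (\<gamma> * (2 - \<gamma>)) * TV \<mu> \<nu>
                / ln (3 + 1 / TV \<mu> \<nu>) powr ((2 * real CARD('n) + \<gamma>) / 4)
              \<le> (2 * c * (8 * (1 + ln (2 * C))) powr ((d + 1) / 2)) * energy_distance \<gamma> \<mu> \<nu>"
      by (simp add: q_def E_def d_def)
  qed
qed

theorem theorem5:
  shows "(\<forall>\<beta>>0. \<exists>C\<^sub>1::real.
            \<forall>\<mu>\<in>smooth_distributions \<beta> :: (real ^ 'n) measure set.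
            \<forall>\<nu>\<in>smooth_distributions \<beta>. \<forall>\<gamma>\<in>{0<..<2}.
              sqrt (\<gamma> * (2 - \<gamma>)) * TV \<mu> \<nu> powr ((2 * \<beta> + real CARD('n) + \<gamma>) / (2 * \<beta>))
              \<le> C\<^sub>1 * ((measure_sobolev_norm \<beta> \<mu>)\<^sup>2 + (measure_sobolev_norm \<beta> \<nu>)\<^sup>2)
                        powr ((real CARD('n) + \<gamma>) / (4 * \<beta>))
                   * energy_distance \<gamma> \<mu> \<nu>)
       \<and> (\<exists>C\<^sub>2::real.
            \<forall>\<mu>\<in>gaussian_mixtures :: (real ^ 'n) measure set.
            \<forall>\<nu>\<in>gaussian_mixtures. \<forall>\<gamma>\<in>{0<..<2}.
              sqrt (\<gamma> * (2 - \<gamma>)) * TV \<mu> \<nu>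
                / ln (3 + 1 / TV \<mu> \<nu>) powr ((2 * real CARD('n) + \<gamma>) / 4)
              \<le> C\<^sub>2 * energy_distance \<gamma> \<mu> \<nu>)"
  using smooth_TV_le_energy_distance gaussian_mixtures_TV_le_energy_distance by blast

end
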